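(* Let $V_h$ be a unitarizable Verma module over $\mathfrak{sl}(2,\mathbb{C})$, realized in $\mathbb{C}[z]$, with operators $L_k$ and $J_k$ ($k\in\mathbb{Z}$), and let $\mathcal{HS}$ be the algebra of Hilbert–Schmidt operators on the Hilbert space completion of $V_h$. (1) The linear map $T$ defined by $T(e_k)=L_k$ ($k\in\mathbb{Z}$) is an absolutely symmetric $\mathcal{HS}$-projective representation of the Witt algebra $\mathfrak{w}^{\mathbb{C}}$ in $V_h$. (2) Adding the operators $J_k$ to the operators $L_k$, i.e. setting $T(e_k)=L_k$, $T(a_k)=J_k$ ($k\in\mathbb{Z}$), $T(c)=0$, one obtains an absolutely symmetric $\mathcal{HS}$-projective representation in $V_h$ of the semidirect sum of the Witt algebra and the infinite-dimensional $\mathbb{Z}$-graded Heisenberg algebra.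
   Context: **Verma modules.** $\mathfrak{sl}(2,\mathbb{C})$ has basis $l_{-1},l_0,l_1$ with $[l_i,l_j]=(i-j)l_{i+j}$. For real $h$, the Verma module $V_h$ of extremal weight $h$ is $\mathbb{C}[z]$ with $$l_{-1}=z,\quad l_0=z\partial_z+h,\quad l_1=z\partial_z^2+2h\partial_z.$$ It is unitarizable if it admits a pre-Hilbert (positive definite Hermitian) structure with $l_i^*=l_{-i}$; this happens exactly for $h>0$, and then the scalar product is unique up to scaling, the monomials $z^n$ are orthogonal and $\|z^n\|^2=n!\,(2h)(2h+1)\cdots(2h+n-1)\,\|1\|^2$. **Operators.** Put $\xi=z\partial_z$; a rational function $f(\xi)$ acts by $f(\xi)z^n=f(n)z^n$, and $z^kf(\xi)$ means first apply $f(\xi)$, then multiply by $z^k$. The $q_R$-conformal symmetries are $$L_k=(\xi+(k+1)h)\partial_z^k\ (k\ge 0),\qquad L_{-k}=z^k\,\frac{\xi+(k+1)h}{(\xi+2h)(\xi+2h+1)\cdots(\xi+2h+k-1)}\ (k\ge1).$$ Further, $D=\partial_z$, $F=z\frac{1}{\xi+2h}$, and $J_k=D^k$, $J_{-k}=F^k$ for $k\ge0$. **Lie algebras.** The Witt algebra $\mathfrak{w}^{\mathbb{C}}$ has basis $e_k$ ($k\in\mathbb{Z}$), with $[e_j,e_k]=(j-k)e_{j+k}$, grading $\deg e_k=k$ and antilinear involution $e_k^*=e_{-k}$. The Heisenberg algebra is the one-dimensional central extension of the abelian Lie algebra $\mathbb{C}[z,z^{-1}]$, with basis $a_k$ ($k\in\mathbb{Z}$,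 corresponding to $z^k$) and central $c$, brackets $[a_n,a_m]=n\,\delta_{n+m,0}\,c$, grading $\deg a_k=k$, $\deg c=0$, and antilinear involution $a_k^*=a_{-k}$, $c^*=c$. In the semidirect sum, $e_n$ acts on $\mathbb{C}[z,z^{-1}]$ as $-z^{n+1}\frac{d}{dz}$, i.e. $[e_n,a_k]=-k\,a_{n+k}$, $[e_n,c]=0$. **$\mathfrak{A}$-projective representations.** Let $\mathfrak{A}$ be an algebra of operators and $\mathfrak{g}$ a Lie algebra. A linear map $T$ from $\mathfrak{g}$ to linear operators (possibly unbounded, here defined on the dense subspace $\mathbb{C}[z]$) is an $\mathfrak{A}$-projective representation if for all $X,Y\in\mathfrak{g}$ the operator $[T(X),T(Y)]-T([X,Y])$ belongs to $\mathfrak{A}$; for $\mathfrak{A}=\mathcal{HS}$ this means that it extends from $\mathbb{C}[z]$ to a Hilbert–Schmidt operator on the completion. It is symmetric if $T(a^* )=T(a)^*$ for all $a\in\mathfrak{g}$ (adjoints understood with respect to the scalar product on $\mathbb{C}[z]$). Suppose $\mathfrak{g}=\oplus_n\mathfrak{g}_n$ is $\mathbb{Z}$-graded with involution satisfying $\mathfrak{g}_n^*=\mathfrak{g}_{-n}$ and fixing the basis elements of degree $0$. Extend $T$ multiplicatively to the tensor algebra $\mathbf{T}^{\cdot}(\mathfrak{g})$, with the induced grading. A symmetric $\mathfrak{A}$-projective representation is absolutely symmetric if $T(a)=T(a)^*$ for every $a$ of degree $0$ that is a real linear combination of tensor monomials in the given basis elements of $\mathfrak{g}$. *)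

theory Defs
  imports "HOL-Analysis.Analysis" "HOL-Computational_Algebra.Polynomial" "HOL-Library.Poly_Mapping"
begin

section \<open>Complex Hilbert spaces\<close>

text \<open>
  A complex Hilbert space is a real Hilbert space with a compatible complex scalar multiplication
  and a complex scalar product (linear in the first argument) whose real part is the given real
  scalar product. Norm, topology and completeness are those of the underlying real Hilbert space.
\<close>

class chilbert_space = real_inner + complete_space +
  fixes scaleC :: "complex \<Rightarrow> 'a \<Rightarrow> 'a"
    and cinner :: "'a \<Rightarrow> 'a \<Rightarrow> complex"
  assumes scaleC_add_right: "scaleC c (x + y) = scaleC c x + scaleC c y"
    and scaleC_add_left: "scaleC (c + d) x = scaleC c x + scaleC d x"
    and scaleC_scaleC: "scaleC c (scaleC d x) = scaleC (c * d) x"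
    and scaleC_of_real: "scaleC (complex_of_real r) x = scaleR r x"
    and cinner_commute: "cinner x y = cnj (cinner y x)"
    and cinner_add_left: "cinner (x + y) z = cinner x z + cinner y z"
    and cinner_scaleC_left: "cinner (scaleC c x) y = c * cinner x y"
    and inner_eq_Re_cinner: "inner x y = Re (cinner x y)"

definition orthonormal_basis :: "'h::chilbert_space set \<Rightarrow> bool" where
  "orthonormal_basis E \<longleftrightarrow>
     (\<forall>e\<in>E. \<forall>f\<in>E. cinner e f = (if e = f then 1 else 0)) \<and>
     (\<forall>x. (\<forall>e\<in>E. cinner x e = 0) \<longrightarrow> x = 0)"

definition hilbert_schmidt :: "('h::chilbert_space \<Rightarrow> 'h) \<Rightarrow> bool" where
  "hilbert_schmidt B \<longleftrightarrow>
     bounded_linear B \<and> (\<forall>c x. B (scaleC c x) = scaleC c (B x)) \<and>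
     (\<exists>E. orthonormal_basis E \<and> (\<lambda>e. (norm (B e))\<^sup>2) summable_on E)"


section \<open>Operators on the space of polynomials\<close>

type_synonym polyop = "complex poly \<Rightarrow> complex poly"
type_synonym polyform = "complex poly \<Rightarrow> complex poly \<Rightarrow> complex"

definition lin_op :: "polyop \<Rightarrow> bool" where
  "lin_op A \<longleftrightarrow> Vector_Spaces.linear smult smult A"

definition commutator :: "polyop \<Rightarrow> polyop \<Rightarrow> polyop" where
  "commutator A B p = A (B p) - B (A p)"

definition pre_hilbert :: "polyform \<Rightarrow> bool" where
  "pre_hilbert ip \<longleftrightarrow>
     (\<forall>p q. ip p q = cnj (ip q p)) \<and>
     (\<forall>p q r. ip (p + q) r = ip p r + ip q r) \<and>
     (\<forall>c p q. ip (smult c p) q = c * ip p q) \<and>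
     (\<forall>p. p \<noteq> 0 \<longrightarrow> Re (ip p p) > 0)"

text \<open>\<open>is_adjoint ip A B\<close> says that \<open>B = A\<^sup>*\<close> on polynomials; such a \<open>B\<close> is unique
  since the form is nondegenerate.\<close>

definition is_adjoint :: "polyform \<Rightarrow> polyop \<Rightarrow> polyop \<Rightarrow> bool" where
  "is_adjoint ip A B \<longleftrightarrow> (\<forall>p q. ip (A p) q = ip p (B q))"

definition is_completion :: "polyform \<Rightarrow> (complex poly \<Rightarrow> 'h::chilbert_space) \<Rightarrow> bool" where
  "is_completion ip \<iota> \<longleftrightarrow>
     (\<forall>p q. \<iota> (p + q) = \<iota> p + \<iota> q) \<and>
     (\<forall>c p. \<iota> (smult c p) = scaleC c (\<iota> p)) \<and>
     (\<forall>p q. cinner (\<iota> p) (\<iota> q) = ip p q) \<and>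
     closure (range \<iota>) = UNIV"

definition HS_ops :: "(complex poly \<Rightarrow> 'h::chilbert_space) \<Rightarrow> polyop set" where
  "HS_ops \<iota> = {A. lin_op A \<and> (\<exists>B. hilbert_schmidt B \<and> (\<forall>p. B (\<iota> p) = \<iota> (A p)))}"


section \<open>Verma modules\<close>

definition xi :: polyop where
  "xi p = [:0, 1:] * pderiv p"

definition xi_fun :: "(complex \<Rightarrow> complex) \<Rightarrow> polyop" where
  "xi_fun f p = (\<Sum>n\<le>degree p. monom (f (of_nat n) * coeff p n) n)"

definition verma_lm1 :: polyop where
  "verma_lm1 p = [:0, 1:] * p"

definition verma_l0 :: "real \<Rightarrow> polyop" where
  "verma_l0 h p = xi p + smult (of_real h) p"

definition verma_l1 :: "real \<Rightarrow> polyop" where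
  "verma_l1 h p = [:0, 1:] * pderiv (pderiv p) + smult (2 * of_real h) (pderiv p)"

definition unitary_structure :: "real \<Rightarrow> polyform \<Rightarrow> bool" where
  "unitary_structure h ip \<longleftrightarrow>
     pre_hilbert ip \<and>
     is_adjoint ip verma_lm1 (verma_l1 h) \<and>
     is_adjoint ip (verma_l0 h) (verma_l0 h) \<and>
     is_adjoint ip (verma_l1 h) verma_lm1"

text \<open>\<open>pochhammer (x + 2h) k\<close> is the product of \<open>x + 2h + i\<close> for \<open>i < k\<close>.\<close>

definition L_op :: "real \<Rightarrow> int \<Rightarrow> polyop" where
  "L_op h k =
     (if k \<ge> 0
      then (\<lambda>p. xi_fun (\<lambda>x. x + (of_int k + 1) * of_real h) ((pderiv ^^ nat k) p))
      else (\<lambda>p. monom 1 (nat (- k)) *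
                xi_fun (\<lambda>x. (x + (of_int (- k) + 1) * of_real h) /
                            pochhammer (x + 2 * of_real h) (nat (- k))) p))"

definition F_op :: "real \<Rightarrow> polyop" where
  "F_op h p = [:0, 1:] * xi_fun (\<lambda>x. 1 / (x + 2 * of_real h)) p"

definition J_op :: "real \<Rightarrow> int \<Rightarrow> polyop" where
  "J_op h k = (if k \<ge> 0 then pderiv ^^ nat k else F_op h ^^ nat (- k))"


section \<open>Graded Lie algebras with involution, given by a basis\<close>

text \<open>
  A complex vector space with basis indexed by \<open>'i\<close> is \<open>'i \<Rightarrow>\<^sub>0 complex\<close>; its tensor algebra
  has the words over the basis as a basis, so it is \<open>'i list \<Rightarrow>\<^sub>0 complex\<close>.
\<close>

abbreviation basis :: "'i \<Rightarrow> 'i \<Rightarrow>\<^sub>0 complex" where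
  "basis i \<equiv> Poly_Mapping.single i 1"

definition pscale :: "complex \<Rightarrow> ('i \<Rightarrow>\<^sub>0 complex) \<Rightarrow> 'i \<Rightarrow>\<^sub>0 complex" where
  "pscale c X = Poly_Mapping.map ((*) c) X"

definition bilinear_ext ::
    "('i \<Rightarrow> 'i \<Rightarrow> 'i \<Rightarrow>\<^sub>0 complex) \<Rightarrow> ('i \<Rightarrow>\<^sub>0 complex) \<Rightarrow> ('i \<Rightarrow>\<^sub>0 complex) \<Rightarrow> 'i \<Rightarrow>\<^sub>0 complex" where
  "bilinear_ext br X Y =
     (\<Sum>i\<in>Poly_Mapping.keys X. \<Sum>j\<in>Poly_Mapping.keys Y.
        pscale (Poly_Mapping.lookup X i * Poly_Mapping.lookup Y j) (br i j))"

definition antilinear_ext :: "('i \<Rightarrow> 'i) \<Rightarrow> ('i \<Rightarrow>\<^sub>0 complex) \<Rightarrow> 'i \<Rightarrow>\<^sub>0 complex" where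
  "antilinear_ext \<sigma> X =
     (\<Sum>i\<in>Poly_Mapping.keys X. Poly_Mapping.single (\<sigma> i) (cnj (Poly_Mapping.lookup X i)))"

definition op_ext :: "('i \<Rightarrow> polyop) \<Rightarrow> ('i \<Rightarrow>\<^sub>0 complex) \<Rightarrow> polyop" where
  "op_ext t X p = (\<Sum>i\<in>Poly_Mapping.keys X. smult (Poly_Mapping.lookup X i) (t i p))"

text \<open>The Lie algebra axioms are multilinear, hence only required on the basis.\<close>

locale graded_star_lie_algebra =
  fixes br :: "'i \<Rightarrow> 'i \<Rightarrow> 'i \<Rightarrow>\<^sub>0 complex"
    and dg :: "'i \<Rightarrow> int"
    and \<sigma> :: "'i \<Rightarrow> 'i"
  assumes br_self: "br i i = 0"
    and br_anti: "br i j = - br j i"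
    and jacobi: "bilinear_ext br (basis i) (br j k) + bilinear_ext br (basis j) (br k i) +
                 bilinear_ext br (basis k) (br i j) = 0"
    and br_graded: "l \<in> Poly_Mapping.keys (br i j) \<Longrightarrow> dg l = dg i + dg j"
    and star_star: "\<sigma> (\<sigma> i) = i"
    and star_br: "antilinear_ext \<sigma> (br i j) = br (\<sigma> j) (\<sigma> i)"
    and dg_star: "dg (\<sigma> i) = - dg i"
    and star_dg_0: "dg i = 0 \<Longrightarrow> \<sigma> i = i"
begin

definition bracket :: "('i \<Rightarrow>\<^sub>0 complex) \<Rightarrow> ('i \<Rightarrow>\<^sub>0 complex) \<Rightarrow> 'i \<Rightarrow>\<^sub>0 complex" where
  "bracket = bilinear_ext br"

definition star :: "('i \<Rightarrow>\<^sub>0 complex) \<Rightarrow> 'i \<Rightarrow>\<^sub>0 complex" where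
  "star = antilinear_ext \<sigma>"

definition projective_rep :: "polyop set \<Rightarrow> (('i \<Rightarrow>\<^sub>0 complex) \<Rightarrow> polyop) \<Rightarrow> bool" where
  "projective_rep \<AA> T \<longleftrightarrow>
     (\<forall>X. lin_op (T X)) \<and>
     (\<forall>X Y p. T (X + Y) p = T X p + T Y p) \<and>
     (\<forall>c X p. T (pscale c X) p = smult c (T X p)) \<and>
     (\<forall>X Y. (\<lambda>p. commutator (T X) (T Y) p - T (bracket X Y) p) \<in> \<AA>)"

definition symmetric_rep :: "polyform \<Rightarrow> (('i \<Rightarrow>\<^sub>0 complex) \<Rightarrow> polyop) \<Rightarrow> bool" where
  "symmetric_rep ip T \<longleftrightarrow> (\<forall>X. is_adjoint ip (T X) (T (star X)))"

text \<open>Multiplicative extension to the tensor algebra: a word acts by the composition of the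
  operators of its letters, the empty word as the identity.\<close>

definition tensor_ext ::
    "(('i \<Rightarrow>\<^sub>0 complex) \<Rightarrow> polyop) \<Rightarrow> ('i list \<Rightarrow>\<^sub>0 complex) \<Rightarrow> polyop" where
  "tensor_ext T = op_ext (\<lambda>w. foldr (\<lambda>i A. T (basis i) \<circ> A) w id)"

definition tensor_homogeneous :: "int \<Rightarrow> ('i list \<Rightarrow>\<^sub>0 complex) \<Rightarrow> bool" where
  "tensor_homogeneous n a \<longleftrightarrow> (\<forall>w\<in>Poly_Mapping.keys a. sum_list (map dg w) = n)"

definition absolutely_symmetric_rep ::
    "polyop set \<Rightarrow> polyform \<Rightarrow> (('i \<Rightarrow>\<^sub>0 complex) \<Rightarrow> polyop) \<Rightarrow> bool" where
  "absolutely_symmetric_rep \<AA> ip T \<longleftrightarrow>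
     projective_rep \<AA> T \<and> symmetric_rep ip T \<and>
     (\<forall>a. tensor_homogeneous 0 a \<and> (\<forall>w. Poly_Mapping.lookup a w \<in> \<real>) \<longrightarrow>
        is_adjoint ip (tensor_ext T a) (tensor_ext T a))"

end

lemma lookup_pscale [simp]: "Poly_Mapping.lookup (pscale c X) i = c * Poly_Mapping.lookup X i"
  by (simp add: pscale_def Poly_Mapping.map.rep_eq when_def)

lemma pscale_single [simp]: "pscale c (Poly_Mapping.single i a) = Poly_Mapping.single i (c * a)"
  by (rule poly_mapping_eqI) (simp add: lookup_single when_def)

lemma pscale_0_right [simp]: "pscale c 0 = 0"
  by (rule poly_mapping_eqI) simp

lemma pscale_0_left [simp]: "pscale 0 X = 0"
  by (rule poly_mapping_eqI) simp

lemma bilinear_ext_single [simp]: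
  "bilinear_ext br (Poly_Mapping.single i a) (Poly_Mapping.single j b) = pscale (a * b) (br i j)"
  by (simp add: bilinear_ext_def)

lemma bilinear_ext_0_right [simp]: "bilinear_ext br X 0 = 0"
  by (simp add: bilinear_ext_def)

lemma antilinear_ext_single [simp]:
  "antilinear_ext \<sigma> (Poly_Mapping.single i a) = Poly_Mapping.single (\<sigma> i) (cnj a)"
  by (simp add: antilinear_ext_def)

lemma antilinear_ext_0 [simp]: "antilinear_ext \<sigma> 0 = 0"
  by (simp add: antilinear_ext_def)


section \<open>The Witt algebra\<close>

definition witt_br :: "int \<Rightarrow> int \<Rightarrow> int \<Rightarrow>\<^sub>0 complex" where
  "witt_br j k = Poly_Mapping.single (j + k) (of_int (j - k))"

interpretation witt: graded_star_lie_algebra witt_br "\<lambda>k. k" uminus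
proof
  fix i j k :: int
  show "bilinear_ext witt_br (basis i) (witt_br j k) + bilinear_ext witt_br (basis j) (witt_br k i) +
        bilinear_ext witt_br (basis k) (witt_br i j) = 0"
    by (rule poly_mapping_eqI)
       (simp add: witt_br_def lookup_add lookup_single when_def algebra_simps)
qed (auto simp: witt_br_def single_uminus [symmetric] add.commute split: if_splits)


section \<open>The semidirect sum of the Witt algebra and the Heisenberg algebra\<close>

datatype wh_index = Witt int | Heis int | Center

fun wh_br :: "wh_index \<Rightarrow> wh_index \<Rightarrow> wh_index \<Rightarrow>\<^sub>0 complex" where
  "wh_br (Witt j) (Witt k) = Poly_Mapping.single (Witt (j + k)) (of_int (j - k))"
| "wh_br (Witt n) (Heis k) = Poly_Mapping.single (Heis (n + k)) (- of_int k)"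
| "wh_br (Heis k) (Witt n) = Poly_Mapping.single (Heis (n + k)) (of_int k)"
| "wh_br (Heis n) (Heis m) = Poly_Mapping.single Center (if n + m = 0 then of_int n else 0)"
| "wh_br Center _ = 0"
| "wh_br _ Center = 0"

fun wh_deg :: "wh_index \<Rightarrow> int" where
  "wh_deg (Witt k) = k"
| "wh_deg (Heis k) = k"
| "wh_deg Center = 0"

fun wh_star :: "wh_index \<Rightarrow> wh_index" where
  "wh_star (Witt k) = Witt (- k)"
| "wh_star (Heis k) = Heis (- k)"
| "wh_star Center = Center"

fun wh_ops :: "real \<Rightarrow> wh_index \<Rightarrow> polyop" where
  "wh_ops h (Witt k) = L_op h k"
| "wh_ops h (Heis k) = J_op h k"
| "wh_ops h Center = (\<lambda>p. 0)"

interpretation witt_heis: graded_star_lie_algebra wh_br wh_deg wh_star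
proof
  fix i j k l :: wh_index
  show "wh_br i i = 0" by (cases i) auto
  show "wh_br i j = - wh_br j i"
    by (cases i; cases j) (auto simp: single_uminus [symmetric] add.commute add_eq_0_iff)
  show "bilinear_ext wh_br (basis i) (wh_br j k) + bilinear_ext wh_br (basis j) (wh_br k i) +
        bilinear_ext wh_br (basis k) (wh_br i j) = 0"
    by (rule poly_mapping_eqI, cases i; cases j; cases k)
       (auto simp: lookup_add lookup_single when_def algebra_simps)
  show "l \<in> Poly_Mapping.keys (wh_br i j) \<Longrightarrow> wh_deg l = wh_deg i + wh_deg j"
    by (cases i; cases j) (auto split: if_splits)
  show "wh_star (wh_star i) = i" by (cases i) auto
  show "antilinear_ext wh_star (wh_br i j) = wh_br (wh_star j) (wh_star i)"
    by (cases i; cases j) (auto simp: add.commute)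
  show "wh_deg (wh_star i) = - wh_deg i" by (cases i) auto
  show "wh_deg i = 0 \<Longrightarrow> wh_star i = i" by (cases i) auto
qed

end

theory Submission
  imports Defs "HOL-Real_Asymp.Real_Asymp"
begin

text \<open>
  All operators involved are weighted shifts \<open>z\<^sup>n \<mapsto> f(n) z\<^bsup>n-k\<^esup>\<close> with a real rational function \<open>f\<close>, where \<open>k\<close>
  is the degree. The monomials are orthogonal with squared norms \<open>w(n)\<close>, and \<open>w(n-k)/w(n)\<close> is of order
  \<open>n\<^bsup>-2k\<^esup>\<close>. The three claims become statements about the weights \<open>f\<close>.

  Symmetry is the identity \<open>f(n) w(n-k) = f\<^sup>*(n-k) w(n)\<close> between the weights \<open>f\<close> of a generator and
  \<open>f\<^sup>*\<close> of its conjugate (lemmas \<open>jcoef_wt\<close> and \<open>lcoef_wt\<close>). Absolute symmetry is automatic for such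
  families: a word of degree 0 in weighted shifts is diagonal with real entries.

  For projectivity, a weighted shift of degree \<open>k\<close> is Hilbert-Schmidt as soon as \<open>f(n) = O(n\<^bsup>k-1\<^esup>)\<close>,
  since then \<open>f(n)\<^sup>2 w(n-k)/w(n) = O(n\<^bsup>-2\<^esup>)\<close> is summable. Thus only the leading terms of the weights
  matter. They are recorded as \<open>f(x) = x\<^sup>m exp(p/x + q/x\<^sup>2 + O(x\<^bsup>-3\<^esup>))\<close>: the data \<open>m, p, q\<close> add up
  under products and change by simple explicit terms under translations \<open>x \<mapsto> x - c\<close>, which is all that
  composing shifts does. For \<open>J\<^sub>k\<close> one has \<open>m = k\<close>, and for \<open>L\<^sub>k\<close> one has \<open>m = k + 1\<close> and, for both
  signs of \<open>k\<close>, \<open>p = p\<^sub>k = (k + 1)(h - k/2)\<close>. In a commutator the leading terms cancel. For \<open>[J\<^sub>j, J\<^sub>k]\<close>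
  this already gives the required order. For \<open>[L\<^sub>j, J\<^sub>k]\<close> and \<open>[L\<^sub>j, L\<^sub>k]\<close> the next terms are those of
  \<open>-k J\<^bsub>j+k\<^esub>\<close> and \<open>(j - k) L\<^bsub>j+k\<^esub>\<close>. In the last case one more order is needed, and it matches because
  the numbers \<open>q\<close> drop out of the difference and
  \<open>j p\<^sub>j - k p\<^sub>k - j k (j - k)/2 = (j - k) p\<^bsub>j+k\<^esub>\<close>.
\<close>

section \<open>Operators on complex Hilbert spaces\<close>

instance chilbert_space \<subseteq> banach ..

lemma scaleC_zero_left [simp]: "scaleC 0 x = (0::'h::chilbert_space)"
  using scaleC_of_real[of 0 x] by simp

lemma scaleC_one [simp]: "scaleC 1 x = (x::'h::chilbert_space)"
  using scaleC_of_real[of 1 x] by simp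

lemma scaleC_scaleR: "scaleC c (scaleR r x) = scaleR r (scaleC c (x::'h::chilbert_space))"
  by (metis scaleC_of_real scaleC_scaleC mult.commute)

lemma cinner_zero_left [simp]: "cinner 0 x = (0::complex)" for x :: "'h::chilbert_space"
  using cinner_add_left[of 0 0 x] by simp

lemma cinner_scaleC_right: "cinner x (scaleC c y) = cnj c * cinner x (y::'h::chilbert_space)"
  by (metis cinner_scaleC_left cinner_commute complex_cnj_mult)

lemma cinner_sum_left: "cinner (\<Sum>i\<in>S. f i) x = (\<Sum>i\<in>S. cinner (f i) (x::'h::chilbert_space))"
  by (induction S rule: infinite_finite_induct) (simp_all add: cinner_add_left)

lemma norm_scaleC: "norm (scaleC c x) = cmod c * norm (x::'h::chilbert_space)"
proof -
  have "(norm (scaleC c x))\<^sup>2 = Re (c * (cnj c * cinner x x))"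
    unfolding power2_norm_eq_inner inner_eq_Re_cinner
    by (simp only: cinner_scaleC_left[of c x "scaleC c x"] cinner_scaleC_right[of x c x])
  also have "\<dots> = Re (complex_of_real ((cmod c)\<^sup>2) * cinner x x)"
    by (simp only: mult.assoc [symmetric] complex_norm_square)
  also have "\<dots> = (cmod c * norm x)\<^sup>2"
    by (simp add: power_mult_distrib power2_norm_eq_inner inner_eq_Re_cinner)
  finally show ?thesis
    by (simp add: power2_eq_iff_nonneg)
qed

lemma bounded_linear_scaleC: "bounded_linear (scaleC c :: 'h::chilbert_space \<Rightarrow> 'h)"
  by (rule bounded_linear_intro[where K = "cmod c"])
     (simp_all add: scaleC_add_right scaleC_scaleR norm_scaleC mult.commute)

text \<open>
  The vector \<open>s\<close> in the proof is the orthogonal projection of \<open>x\<close> to the span of the first \<open>N\<close>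
  vectors, and the claim is that \<open>x - s\<close> has nonnegative squared norm.
\<close>
lemma bessel_inequality:
  fixes e :: "nat \<Rightarrow> 'h::chilbert_space"
  assumes on: "\<And>m n. cinner (e m) (e n) = (if m = n then 1 else 0)"
  shows "(\<Sum>n<N. (cmod (cinner x (e n)))\<^sup>2) \<le> (norm x)\<^sup>2"
proof -
  define s where "s = (\<Sum>n<N. scaleC (cinner x (e n)) (e n))"
  define S where "S = (\<Sum>n<N. (cmod (cinner x (e n)))\<^sup>2)"
  have se: "cinner s (e m) = cinner x (e m)" if "m < N" for m
    using that by (simp add: s_def cinner_sum_left cinner_scaleC_left on if_distrib sum.delta cong: if_cong)
  have sy: "cinner s y = (\<Sum>n<N. cinner x (e n) * cnj (cinner y (e n)))" for y
    unfolding s_def cinner_sum_left cinner_scaleC_left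
    by (metis (no_types, lifting) cinner_commute)
  have "cinner s x = of_real S"
    unfolding S_def sy of_real_sum
    by (rule sum.cong) (simp_all only: complex_norm_square)
  moreover have "cinner s s = of_real S"
    unfolding S_def sy[of s] of_real_sum
    by (rule sum.cong) (simp_all only: se lessThan_iff complex_norm_square)
  ultimately have "inner s s = S" "inner s x = S"
    by (simp_all add: inner_eq_Re_cinner)
  moreover have "0 \<le> inner (x - s) (x - s)"
    by simp
  ultimately show ?thesis
    by (simp add: inner_diff inner_commute power2_norm_eq_inner S_def)
qed

text \<open>
  A square-summable prescription on an orthonormal sequence extends to a bounded operator: by the
  Cauchy-Schwarz and Bessel inequalities the series \<open>\<Sum>\<^sub>n \<langle>x, e\<^sub>n\<rangle> f\<^sub>n\<close> converges absolutely, with norm at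
  most \<open>\<parallel>x\<parallel>\<close> times the square root of \<open>\<Sum>\<^sub>n \<parallel>f\<^sub>n\<parallel>\<^sup>2\<close>.
\<close>
lemma orthonormal_sequence_operator:
  fixes e f :: "nat \<Rightarrow> 'h::chilbert_space"
  assumes on: "\<And>m n. cinner (e m) (e n) = (if m = n then 1 else 0)"
    and sf: "summable (\<lambda>n. (norm (f n))\<^sup>2)"
  obtains B where "bounded_linear B" "\<And>c x. B (scaleC c x) = scaleC c (B x)" "\<And>n. B (e n) = f n"
proof -
  define M where "M = sqrt (suminf (\<lambda>n. (norm (f n))\<^sup>2))"
  have part: "(\<Sum>n<N. norm (scaleC (cinner x (e n)) (f n))) \<le> norm x * M" for x N
  proof -
    have "(\<Sum>n<N. norm (scaleC (cinner x (e n)) (f n))) = (\<Sum>n<N. \<bar>cmod (cinner x (e n))\<bar> * \<bar>norm (f n)\<bar>)"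
      by (simp add: norm_scaleC)
    also have "\<dots> \<le> L2_set (\<lambda>n. cmod (cinner x (e n))) {..<N} * L2_set (\<lambda>n. norm (f n)) {..<N}"
      by (rule L2_set_mult_ineq)
    also have "\<dots> \<le> norm x * M"
    proof (rule mult_mono)
      show "L2_set (\<lambda>n. cmod (cinner x (e n))) {..<N} \<le> norm x"
        unfolding L2_set_def by (rule real_le_lsqrt) (simp_all add: bessel_inequality[OF on] sum_nonneg)
      show "L2_set (\<lambda>n. norm (f n)) {..<N} \<le> M"
        unfolding L2_set_def M_def by (intro real_sqrt_le_mono sum_le_suminf sf) auto
    qed (auto simp: L2_set_nonneg)
    finally show ?thesis .
  qed
  have sn: "summable (\<lambda>n. norm (scaleC (cinner x (e n)) (f n)))" for x
    by (rule bounded_imp_summable[where B = "norm x * M"])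
       (simp_all only: lessThan_Suc_atMost [symmetric] part norm_ge_zero)
  have sm: "summable (\<lambda>n. scaleC (cinner x (e n)) (f n))" for x
    by (rule summable_norm_cancel) (rule sn)
  define B where "B = (\<lambda>x. suminf (\<lambda>n. scaleC (cinner x (e n)) (f n)))"
  have sc: "B (scaleC c x) = scaleC c (B x)" for c x
    unfolding B_def bounded_linear.suminf[OF bounded_linear_scaleC sm]
    by (simp add: cinner_scaleC_left scaleC_scaleC)
  have "bounded_linear B"
  proof (rule bounded_linear_intro[where K = M])
    show "B (x + y) = B x + B y" for x y
      unfolding B_def by (simp add: suminf_add[OF sm sm] cinner_add_left scaleC_add_left)
    show "B (r *\<^sub>R x) = r *\<^sub>R B x" for r x
      by (simp only: scaleC_of_real [symmetric] sc)
    show "norm (B x) \<le> norm x * M" for x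
    proof -
      have "norm (B x) \<le> (suminf (\<lambda>n. norm (scaleC (cinner x (e n)) (f n))))"
        unfolding B_def by (rule summable_norm) (rule sn)
      also have "\<dots> \<le> norm x * M"
        by (rule suminf_le_const[OF sn part])
      finally show ?thesis .
    qed
  qed
  moreover have "B (e n) = f n" for n
  proof -
    have "B (e n) = (\<Sum>m\<in>{n}. scaleC (cinner (e n) (e m)) (f m))"
      unfolding B_def by (rule suminf_finite) (simp_all add: on)
    then show ?thesis by (simp add: on)
  qed
  ultimately show ?thesis using that sc by blast
qed

section \<open>Logarithmic expansions at infinity\<close>

text \<open>
  This says \<open>f(x) = x\<^sup>m exp(p/x + q/x\<^sup>2 + O(x\<^bsup>-3\<^esup>))\<close>, with the exponential expanded; hence the
  coefficient \<open>q + p\<^sup>2/2\<close>. Taking \<open>q\<close> rather than this coefficient as parameter makes the parameters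
  additive under products.
\<close>
definition log_expansion :: "(real \<Rightarrow> real) \<Rightarrow> int \<Rightarrow> real \<Rightarrow> real \<Rightarrow> bool" where
  "log_expansion f m p q \<longleftrightarrow>
     (\<lambda>x. f x / x powi m - (1 + p / x + (q + p\<^sup>2 / 2) / x\<^sup>2)) \<in> O(\<lambda>x. 1 / x ^ 3)"

lemma bigo_mult_bounded: "f \<in> O[F](h) \<Longrightarrow> g \<in> O[F](\<lambda>_. 1) \<Longrightarrow> (\<lambda>x. f x * g x :: real) \<in> O[F](h)"
  using landau_o.big.mult[of f F h g "\<lambda>_. 1"] by simp

lemma inverse_power_bigo:
  fixes c :: real
  assumes "n \<ge> k"
  shows "(\<lambda>x. c / x ^ n) \<in> O(\<lambda>x. 1 / x ^ k)"
proof (rule bigoI[where c = "\<bar>c\<bar>"])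
  show "\<forall>\<^sub>F x::real in at_top. norm (c / x ^ n) \<le> \<bar>c\<bar> * norm (1 / x ^ k)"
    using eventually_ge_at_top[of 1]
  proof eventually_elim
    case (elim x)
    then have "\<bar>c\<bar> * x ^ k \<le> \<bar>c\<bar> * x ^ n"
      using assms by (intro mult_left_mono power_increasing) auto
    then show ?case using elim by (simp add: field_simps)
  qed
qed

lemma log_expansion_mult:
  assumes "log_expansion f m p q" "log_expansion g m' p' q'"
  shows "log_expansion (\<lambda>x. f x * g x) (m + m') (p + p') (q + q')"
proof -
  define b b' where "b = q + p\<^sup>2 / 2" and "b' = q' + p'\<^sup>2 / 2"
  define u v where "u = (\<lambda>x::real. 1 + p / x + b / x\<^sup>2)" and "v = (\<lambda>x::real. 1 + p' / x + b' / x\<^sup>2)"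
  define r s where "r = (\<lambda>x. f x / x powi m - u x)" and "s = (\<lambda>x. g x / x powi m' - v x)"
  have rs: "r \<in> O(\<lambda>x. 1 / x ^ 3)" "s \<in> O(\<lambda>x. 1 / x ^ 3)"
    using assms by (simp_all add: log_expansion_def r_def s_def u_def v_def b_def b'_def)
  have one: "u \<in> O(\<lambda>_. 1)" "v \<in> O(\<lambda>_. 1)" "(\<lambda>x::real. 1 / x ^ 3) \<in> O(\<lambda>_. 1)"
    unfolding u_def v_def by real_asymp+
  have s1: "s \<in> O(\<lambda>_. 1)"
    using rs(2) one(3) by (rule landau_o.big.trans)
  have "(\<lambda>x. u x * s x + r x * v x + r x * s x + ((p * b' + p' * b) / x ^ 3 + b * b' / x ^ 4))
          \<in> O(\<lambda>x. 1 / x ^ 3)"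
    using bigo_mult_bounded[OF rs(2) one(1)]
    by (intro sum_in_bigo bigo_mult_bounded[OF rs(1)] inverse_power_bigo s1 one(2)) (simp_all add: mult.commute)
  also have "?this \<longleftrightarrow> (\<lambda>x. f x * g x / x powi (m + m') -
      (1 + (p + p') / x + (q + q' + (p + p')\<^sup>2 / 2) / x\<^sup>2)) \<in> O(\<lambda>x. 1 / x ^ 3)"
  proof (rule landau_o.big.in_cong)
    show "\<forall>\<^sub>F x in at_top. u x * s x + r x * v x + r x * s x + ((p * b' + p' * b) / x ^ 3 + b * b' / x ^ 4)
       = f x * g x / x powi (m + m') - (1 + (p + p') / x + (q + q' + (p + p')\<^sup>2 / 2) / x\<^sup>2)"
      using eventually_gt_at_top[of 0]
    proof eventually_elim
      case (elim x)
      have "f x * g x / x powi (m + m') = (f x / x powi m) * (g x / x powi m')"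
        using elim by (simp add: power_int_add)
      also have "\<dots> = (u x + r x) * (v x + s x)" by (simp add: r_def s_def)
      finally have *: "f x * g x / x powi (m + m') = u x * v x + (u x * s x + r x * v x + r x * s x)"
        by (simp add: algebra_simps)
      have "u x * v x = 1 + (p + p') / x + (q + q' + (p + p')\<^sup>2 / 2) / x\<^sup>2
              + ((p * b' + p' * b) / x ^ 3 + b * b' / x ^ 4)"
        using elim unfolding u_def v_def b_def b'_def
        by (simp add: field_simps power2_eq_square power3_eq_cube power4_eq_xxxx)
      then show ?case unfolding * by simp
    qed
  qed
  finally show ?thesis by (simp add: log_expansion_def)
qed

lemma log_expansion_one: "log_expansion (\<lambda>x. 1) 0 0 0"
  by (simp add: log_expansion_def)

lemma log_expansion_prod:
  fixes n :: nat
  assumes "\<And>i. i < n \<Longrightarrow> log_expansion (f i) (m i) (p i) (q i)"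
  shows "log_expansion (\<lambda>x. \<Prod>i<n. f i x) (\<Sum>i<n. m i) (\<Sum>i<n. p i) (\<Sum>i<n. q i)"
  using assms by (induction n) (simp_all add: log_expansion_one log_expansion_mult)

lemma log_expansion_linear: "log_expansion (\<lambda>x. x + c) 1 c (- c\<^sup>2 / 2)"
proof -
  have "\<forall>\<^sub>F x in at_top. (x + c) / x powi 1 - (1 + c / x + (- c\<^sup>2 / 2 + c\<^sup>2 / 2) / x\<^sup>2) = 0"
    using eventually_gt_at_top[of 0] by eventually_elim (simp add: field_simps)
  then show ?thesis
    unfolding log_expansion_def by (rule iffD2[OF landau_o.big.in_cong]) auto
qed

lemma log_expansion_inverse_linear: "log_expansion (\<lambda>x. 1 / (x + c)) (- 1) (- c) (c\<^sup>2 / 2)"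
proof -
  have "\<forall>\<^sub>F x in at_top. 1 / (x + c) / x powi (- 1) - (1 + (- c) / x + (c\<^sup>2 / 2 + (- c)\<^sup>2 / 2) / x\<^sup>2)
          = (- (c ^ 3) / x ^ 3) * (x / (x + c))"
    using eventually_gt_at_top[of "max 0 (- c)"]
  proof eventually_elim
    case (elim x)
    \<comment> \<open>The error of the truncated geometric series for \<open>t = 1/(1 + s)\<close> is exactly \<open>-s\<^sup>3 t\<close>.\<close>
    define t where "t = x / (x + c)"
    define s where "s = c / x"
    have "t * (1 + s) = 1"
      using elim by (auto simp: t_def s_def add_divide_distrib [symmetric] divide_simps)
    then have "t - (1 - s + s\<^sup>2) = - (s ^ 3 * t)"
      by algebra
    moreover have "1 / (x + c) / x powi (- 1) = t"
      using elim by (simp add: t_def divide_simps)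
    ultimately show ?case
      by (simp add: s_def t_def power_divide)
  qed
  moreover have "(\<lambda>x. (- (c ^ 3) / x ^ 3) * (x / (x + c))) \<in> O(\<lambda>x. 1 / x ^ 3)"
    by (intro bigo_mult_bounded inverse_power_bigo) (simp, real_asymp)
  ultimately show ?thesis
    unfolding log_expansion_def by (rule iffD2[OF landau_o.big.in_cong])
qed

lemma log_expansion_powi:
  "log_expansion (\<lambda>x. (x - c) powi m) m (- (of_int m * c)) (- (of_int m * c\<^sup>2 / 2))"
proof (cases "m \<ge> 0")
  case True
  have "log_expansion (\<lambda>x. \<Prod>i<nat m. x + (- c)) (\<Sum>i<nat m. 1) (\<Sum>i<nat m. - c) (\<Sum>i<nat m. - (- c)\<^sup>2 / 2)"
    by (intro log_expansion_prod log_expansion_linear)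
  with True show ?thesis by (simp add: power_int_def)
next
  case False
  have "log_expansion (\<lambda>x. \<Prod>i<nat (- m). 1 / (x + (- c))) (\<Sum>i<nat (- m). - 1)
          (\<Sum>i<nat (- m). - (- c)) (\<Sum>i<nat (- m). (- c)\<^sup>2 / 2)"
    by (intro log_expansion_prod log_expansion_inverse_linear)
  with False show ?thesis by (simp add: power_int_def inverse_eq_divide)
qed

text \<open>
  Write \<open>f(x - c) = (x - c)\<^sup>m g(x - c)\<close> with \<open>g(x) = f(x)/x\<^sup>m\<close>. The first factor contributes
  \<open>-mc/x - mc\<^sup>2/(2x\<^sup>2)\<close> to the exponent, and in the second one \<open>p/(x - c) = p/x + cp/x\<^sup>2 + O(x\<^bsup>-3\<^esup>)\<close>.
\<close>
lemma log_expansion_shift: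
  assumes "log_expansion f m p q"
  shows "log_expansion (\<lambda>x. f (x - c)) m (p - of_int m * c) (q + c * p - of_int m * c\<^sup>2 / 2)"
proof -
  define b where "b = q + p\<^sup>2 / 2"
  define g where "g = (\<lambda>x. f x / x powi m)"
  have lim: "filterlim (\<lambda>x::real. x - c) at_top at_top"
    by real_asymp
  have "(\<lambda>x. g x - (1 + p / x + b / x\<^sup>2)) \<in> O(\<lambda>x. 1 / x ^ 3)"
    using assms by (simp add: log_expansion_def g_def b_def)
  from landau_o.big.compose[OF this lim]
  have "(\<lambda>x. g (x - c) - (1 + p / (x - c) + b / (x - c)\<^sup>2)) \<in> O(\<lambda>x. 1 / (x - c) ^ 3)" .
  moreover have "(\<lambda>x. 1 / (x - c) ^ 3) \<in> O(\<lambda>x. 1 / x ^ 3)"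
    by real_asymp
  ultimately have 1: "(\<lambda>x. g (x - c) - (1 + p / (x - c) + b / (x - c)\<^sup>2)) \<in> O(\<lambda>x. 1 / x ^ 3)"
    by (rule landau_o.big.trans)
  have 2: "(\<lambda>x. (p * c\<^sup>2 / x ^ 3) * (x / (x - c)) + (2 * b * c / x ^ 3) * (x ^ 2 / (x - c) ^ 2)
              - (b * c\<^sup>2 / x ^ 4) * (x ^ 2 / (x - c) ^ 2)) \<in> O(\<lambda>x. 1 / x ^ 3)"
    by (intro sum_in_bigo bigo_mult_bounded inverse_power_bigo) (simp_all, real_asymp+)
  have "(\<lambda>x. g (x - c) / x powi 0 - (1 + p / x + (q + c * p + p\<^sup>2 / 2) / x\<^sup>2)) \<in> O(\<lambda>x. 1 / x ^ 3)"
  proof (rule iffD2[OF landau_o.big.in_cong])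
    show "\<forall>\<^sub>F x in at_top. g (x - c) / x powi 0 - (1 + p / x + (q + c * p + p\<^sup>2 / 2) / x\<^sup>2)
        = (g (x - c) - (1 + p / (x - c) + b / (x - c)\<^sup>2)) +
          ((p * c\<^sup>2 / x ^ 3) * (x / (x - c)) + (2 * b * c / x ^ 3) * (x ^ 2 / (x - c) ^ 2)
              - (b * c\<^sup>2 / x ^ 4) * (x ^ 2 / (x - c) ^ 2))"
      using eventually_gt_at_top[of "max 0 c"]
    proof eventually_elim
      case (elim x)
      then have nz: "x \<noteq> 0" "x - c \<noteq> 0" by auto
      define y where "y = x - c"
      have c: "c = x - y" by (simp add: y_def)
      have y: "y \<noteq> 0" using nz by (simp add: y_def)
      \<comment> \<open>With \<open>s = c/x\<close> and \<open>t = x/(x - c)\<close> one has \<open>t(1 - s) = 1\<close>, and both identities are polynomial consequences.\<close>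
      define t where "t = x / y"
      define s where "s = c / x"
      have st: "t * (1 - s) = 1"
        using nz(1) y by (simp add: t_def s_def c diff_divide_distrib)
      have "t = 1 + s + s\<^sup>2 * t"
        using st by algebra
      then have "p / x * t = p / x * (1 + s + s\<^sup>2 * t)"
        by (rule arg_cong)
      then have "p / y - p / x - c * p / x\<^sup>2 = (p * c\<^sup>2 / x ^ 3) * (x / y)"
        using nz(1) by (simp add: s_def t_def distrib_left power2_eq_square power3_eq_cube mult_ac)
      moreover have "t\<^sup>2 = 1 + 2 * s * t\<^sup>2 - s\<^sup>2 * t\<^sup>2"
        using st by algebra
      then have "b / x\<^sup>2 * t\<^sup>2 = b / x\<^sup>2 * (1 + 2 * s * t\<^sup>2 - s\<^sup>2 * t\<^sup>2)"
        by (rule arg_cong)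
      then have "b / y\<^sup>2 - b / x\<^sup>2 = (2 * b * c / x ^ 3) * (x ^ 2 / y ^ 2) - (b * c\<^sup>2 / x ^ 4) * (x ^ 2 / y ^ 2)"
        using nz(1) by (simp add: s_def t_def distrib_left right_diff_distrib power_divide power2_eq_square
            power3_eq_cube power4_eq_xxxx mult_ac)
      ultimately show ?case
        unfolding y_def [symmetric] b_def by (simp add: add_divide_distrib algebra_simps)
    qed
  qed (intro sum_in_bigo 1 2)
  then have "log_expansion (\<lambda>x. g (x - c)) 0 p (q + c * p)"
    by (simp add: log_expansion_def)
  from log_expansion_mult[OF log_expansion_powi[of c m] this]
  have "log_expansion (\<lambda>x. (x - c) powi m * g (x - c)) m (p - of_int m * c) (q + c * p - of_int m * c\<^sup>2 / 2)"
    by (simp add: algebra_simps)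
  moreover have "\<forall>\<^sub>F x in at_top. (x - c) powi m * g (x - c) = f (x - c)"
    using eventually_gt_at_top[of c] by eventually_elim (simp add: g_def)
  then have "\<forall>\<^sub>F x in at_top. (x - c) powi m * g (x - c) / x powi m - r x = f (x - c) / x powi m - r x" for r
    by eventually_elim simp
  note iffD1[OF landau_o.big.in_cong[OF this]]
  ultimately show ?thesis
    unfolding log_expansion_def by simp
qed

lemma bigo_power_int:
  assumes "(\<lambda>x::real. f x / x powi m) \<in> O(\<lambda>x. 1 / x ^ n)"
  shows "f \<in> O(\<lambda>x. x powi (m - int n))"
proof -
  have "(\<lambda>x. x powi m * (f x / x powi m)) \<in> O(\<lambda>x::real. x powi m * (1 / x ^ n))"
    by (intro landau_o.big.mult assms) simp
  then show ?thesis
  proof (rule landau_o.big.cong_ex[THEN iffD1, rotated 2])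
    show "\<forall>\<^sub>F x::real in at_top. x powi m * (f x / x powi m) = f x"
      using eventually_gt_at_top[of 0] by eventually_elim simp
    show "\<forall>\<^sub>F x::real in at_top. x powi m * (1 / x ^ n) = x powi (m - int n)"
      using eventually_gt_at_top[of 0] by eventually_elim (simp add: power_int_diff)
  qed
qed

lemma log_expansion_order2:
  assumes "log_expansion f m p q"
  shows "(\<lambda>x. f x / x powi m - (1 + p / x)) \<in> O(\<lambda>x. 1 / x ^ 2)"
proof -
  have "(\<lambda>x. f x / x powi m - (1 + p / x + (q + p\<^sup>2 / 2) / x\<^sup>2)) \<in> O(\<lambda>x. 1 / x ^ 2)"
    using assms unfolding log_expansion_def by (rule landau_o.big.trans) real_asymp
  moreover have "(\<lambda>x. (q + p\<^sup>2 / 2) / x ^ 2) \<in> O(\<lambda>x. 1 / x ^ 2)"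
    by (rule inverse_power_bigo) simp
  ultimately show ?thesis
    by (rule landau_o.big.cong_ex[THEN iffD1, OF _ _ sum_in_bigo(1), rotated 2]) simp_all
qed

lemma log_expansion_order1:
  assumes "log_expansion f m p q"
  shows "(\<lambda>x. f x / x powi m - 1) \<in> O(\<lambda>x. 1 / x)"
proof -
  have "(\<lambda>x. f x / x powi m - (1 + p / x)) \<in> O(\<lambda>x. 1 / x)"
    using log_expansion_order2[OF assms] by (rule landau_o.big.trans) real_asymp
  moreover have "(\<lambda>x. p / x) \<in> O(\<lambda>x. 1 / x)"
    using inverse_power_bigo[of 1 1 p] by simp
  ultimately show ?thesis
    by (rule landau_o.big.cong_ex[THEN iffD1, OF _ _ sum_in_bigo(1), rotated 2]) simp_all
qed

lemma log_expansion_bigtheta: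
  assumes "log_expansion f m p q"
  shows "f \<in> \<Theta>(\<lambda>x. x powi m)"
proof -
  have "((\<lambda>x. f x / x powi m - 1) \<longlongrightarrow> 0) at_top"
  proof (rule smalloD_tendsto[where f = "\<lambda>x. f x / x powi m - 1" and g = "\<lambda>_. 1", simplified])
    show "(\<lambda>x. f x / x powi m - 1) \<in> o(\<lambda>_. 1)"
      using log_expansion_order1[OF assms]
      by (rule landau_o.big_small_trans) real_asymp
  qed
  from tendsto_add[OF this tendsto_const[of 1]]
  have "((\<lambda>x. f x / x powi m) \<longlongrightarrow> 1) at_top" by simp
  then show ?thesis
    by (rule bigthetaI_tendsto[rotated]) simp
qed

text \<open>
  The next three lemmas compare two functions with the same leading term \<open>x\<^sup>m\<close>. The first one only uses
  that these terms cancel. In the other two a multiple of a function \<open>r\<close> with leading term \<open>x\<^bsup>m-1\<^esup>\<close> is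
  subtracted as well, so that one or two further coefficients have to agree.
\<close>
lemma log_expansion_diff1:
  assumes "log_expansion f m p q" "log_expansion g m p' q'"
  shows "(\<lambda>x. f x - g x) \<in> O(\<lambda>x. x powi (m - 1))"
proof -
  have "(\<lambda>x. (f x - g x) / x powi m) \<in> O(\<lambda>x. 1 / x ^ 1)"
    using sum_in_bigo(2)[OF assms[THEN log_expansion_order1]] by (simp add: diff_divide_distrib)
  from bigo_power_int[OF this] show ?thesis by simp
qed

lemma log_expansion_diff2:
  assumes "log_expansion f m p q" "log_expansion g m p' q'" "log_expansion r (m - 1) p'' q''"
    and d: "p - p' = d"
  shows "(\<lambda>x. f x - g x - d * r x) \<in> O(\<lambda>x. x powi (m - 2))"
proof -
  have "(\<lambda>x. r x / x powi (m - 1) - 1) \<in> O(\<lambda>x. 1 / x)"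
    by (rule log_expansion_order1[OF assms(3)])
  then have "(\<lambda>x. d / x * (r x / x powi (m - 1) - 1)) \<in> O(\<lambda>x. 1 / x * (1 / x))"
    by (intro landau_o.big.mult) (use inverse_power_bigo[of 1 1 d] in simp)
  then have "(\<lambda>x. (f x / x powi m - (1 + p / x)) - (g x / x powi m - (1 + p' / x))
               - d / x * (r x / x powi (m - 1) - 1)) \<in> O(\<lambda>x. 1 / x ^ 2)"
    by (intro sum_in_bigo(2) assms(1,2)[THEN log_expansion_order2]) (simp add: power2_eq_square)
  then have "(\<lambda>x. (f x - g x - d * r x) / x powi m) \<in> O(\<lambda>x. 1 / x ^ 2)"
  proof (rule landau_o.big.in_cong[THEN iffD1, rotated])
    show "\<forall>\<^sub>F x in at_top. (f x / x powi m - (1 + p / x)) - (g x / x powi m - (1 + p' / x))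
               - d / x * (r x / x powi (m - 1) - 1) = (f x - g x - d * r x) / x powi m"
      using eventually_gt_at_top[of 0]
    proof eventually_elim
      case (elim x)
      have "r x / x powi (m - 1) = x * (r x / x powi m)"
        using elim by (simp add: power_int_diff)
      moreover have "p / x = p' / x + d / x"
        using d by (simp add: add_divide_distrib [symmetric])
      ultimately show ?case
        using elim by (simp add: diff_divide_distrib right_diff_distrib)
    qed
  qed
  from bigo_power_int[OF this] show ?thesis by simp
qed

lemma log_expansion_diff3:
  assumes "log_expansion f m p q" "log_expansion g m p' q'" "log_expansion r (m - 1) p'' q''"
    and d: "p - p' = d" and dp: "(q + p\<^sup>2 / 2) - (q' + p'\<^sup>2 / 2) = d * p''"
  shows "(\<lambda>x. f x - g x - d * r x) \<in> O(\<lambda>x. x powi (m - 3))"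
proof -
  define b b' where "b = q + p\<^sup>2 / 2" and "b' = q' + p'\<^sup>2 / 2"
  have "(\<lambda>x. r x / x powi (m - 1) - (1 + p'' / x)) \<in> O(\<lambda>x. 1 / x ^ 2)"
    by (rule log_expansion_order2[OF assms(3)])
  then have "(\<lambda>x. d / x * (r x / x powi (m - 1) - (1 + p'' / x))) \<in> O(\<lambda>x. 1 / x * (1 / x ^ 2))"
    by (intro landau_o.big.mult) (use inverse_power_bigo[of 1 1 d] in simp)
  then have "(\<lambda>x. (f x / x powi m - (1 + p / x + b / x\<^sup>2)) - (g x / x powi m - (1 + p' / x + b' / x\<^sup>2))
               - d / x * (r x / x powi (m - 1) - (1 + p'' / x))) \<in> O(\<lambda>x. 1 / x ^ 3)"
    using sum_in_bigo(2)[OF sum_in_bigo(2)[OF assms(1,2)[unfolded log_expansion_def, folded b_def b'_def]]]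
    by (simp only: times_divide_times_eq mult_1 power_Suc [symmetric] numeral_3_eq_3 numeral_2_eq_2)
  then have "(\<lambda>x. (f x - g x - d * r x) / x powi m) \<in> O(\<lambda>x. 1 / x ^ 3)"
  proof (rule landau_o.big.in_cong[THEN iffD1, rotated])
    show "\<forall>\<^sub>F x in at_top. (f x / x powi m - (1 + p / x + b / x\<^sup>2)) - (g x / x powi m - (1 + p' / x + b' / x\<^sup>2))
               - d / x * (r x / x powi (m - 1) - (1 + p'' / x)) = (f x - g x - d * r x) / x powi m"
      using eventually_gt_at_top[of 0]
    proof eventually_elim
      case (elim x)
      have "r x / x powi (m - 1) = x * (r x / x powi m)"
        using elim by (simp add: power_int_diff)
      moreover have "p / x = p' / x + d / x"
        using d by (simp add: add_divide_distrib [symmetric])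
      moreover have "b / x\<^sup>2 = b' / x\<^sup>2 + d * p'' / x\<^sup>2"
        using dp by (simp add: add_divide_distrib [symmetric] b_def b'_def)
      ultimately show ?case
        using elim by (simp add: diff_divide_distrib right_diff_distrib distrib_left power2_eq_square)
    qed
  qed
  from bigo_power_int[OF this] show ?thesis by simp
qed

section \<open>Weights of the conformal symmetries\<close>

text \<open>
  The weight functions of \<open>J\<^sub>k\<close> and \<open>L\<^sub>k\<close>. The factors are written as \<open>x + c\<close> so that the expansion of
  a linear factor applies to them directly.
\<close>
definition jcoef :: "real \<Rightarrow> int \<Rightarrow> real \<Rightarrow> real" where
  "jcoef h k x = (if k \<ge> 0 then \<Prod>i<nat k. x + - real i else \<Prod>i<nat (- k). 1 / (x + (2 * h + real i)))"

definition lcoef :: "real \<Rightarrow> int \<Rightarrow> real \<Rightarrow> real" where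
  "lcoef h k x = (x + (if k \<ge> 0 then (of_int k + 1) * h - of_int k else (1 - of_int k) * h)) * jcoef h k x"

definition jcoef_subleading :: "real \<Rightarrow> int \<Rightarrow> real" where
  "jcoef_subleading h k = (if k \<ge> 0 then - (of_int k * (of_int k - 1) / 2)
                    else 2 * h * of_int k - of_int k * (of_int k + 1) / 2)"

lemma sum_real_lessThan: "(\<Sum>i<n. real i) = real n * (real n - 1) / 2"
  by (induction n) (simp_all add: field_simps)

lemma jcoef_expansion:
  "\<exists>q. log_expansion (jcoef h k) k (jcoef_subleading h k) q"
proof (cases "k \<ge> 0")
  case True
  have "log_expansion (\<lambda>x. \<Prod>i<nat k. x + - real i) (\<Sum>i<nat k. 1) (\<Sum>i<nat k. - real i)
          (\<Sum>i<nat k. - (- real i)\<^sup>2 / 2)"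
    by (intro log_expansion_prod log_expansion_linear)
  with True show ?thesis
    by (auto simp: jcoef_def [abs_def] jcoef_subleading_def sum_negf sum_real_lessThan)
next
  case False
  have "log_expansion (\<lambda>x. \<Prod>i<nat (- k). 1 / (x + (2 * h + real i))) (\<Sum>i<nat (- k). - 1)
          (\<Sum>i<nat (- k). - (2 * h + real i)) (\<Sum>i<nat (- k). (2 * h + real i)\<^sup>2 / 2)"
    by (intro log_expansion_prod log_expansion_inverse_linear)
  moreover have "(\<Sum>i<nat (- k). - (2 * h + real i)) = 2 * h * of_int k - of_int k * (of_int k + 1) / 2"
    using False unfolding sum_negf sum.distrib sum_real_lessThan by (simp add: field_simps)
  ultimately show ?thesis
    using False by (auto simp: jcoef_def [abs_def] jcoef_subleading_def)
qed

text \<open>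
  The two cases in the definitions of the weights lead to one and the same formula for \<open>p\<close>. This is
  what makes the operators \<open>L\<^sub>k\<close> of positive and negative degree fit together to a projective
  representation.
\<close>
lemma lcoef_expansion:
  "\<exists>q. log_expansion (lcoef h k) (k + 1) ((of_int k + 1) * (h - of_int k / 2)) q"
proof -
  obtain q where q: "log_expansion (jcoef h k) k (jcoef_subleading h k) q"
    using jcoef_expansion by blast
  show ?thesis
    using log_expansion_mult[OF log_expansion_linear
        [of "if k \<ge> 0 then (of_int k + 1) * h - of_int k else (1 - of_int k) * h"] q]
    by (auto simp: lcoef_def [abs_def] jcoef_subleading_def add.commute field_simps split: if_splits)
qed

lemma jcoef_expansion_choice: "\<exists>q. \<forall>k. log_expansion (jcoef h k) k (jcoef_subleading h k) (q k)"
  by (rule choice, rule allI, rule jcoef_expansion)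

lemma lcoef_expansion_choice:
  "\<exists>q. \<forall>k. log_expansion (lcoef h k) (k + 1) ((of_int k + 1) * (h - of_int k / 2)) (q k)"
  by (rule choice, rule allI, rule lcoef_expansion)

text \<open>
  The weight of the composition \<open>L\<^sub>j L\<^sub>k\<close> at \<open>x\<close> is \<open>lcoef h k x * lcoef h j (x - k)\<close>. Its parameter \<open>p\<close> exceeds
  that of \<open>L\<^sub>k L\<^sub>j\<close> by \<open>j - k\<close>; at the next order the unknown numbers \<open>q\<close> cancel and the identity
  \<open>j p\<^sub>j - k p\<^sub>k - j k (j - k)/2 = (j - k) p\<^bsub>j+k\<^esub>\<close> remains.
\<close>
lemma lcoef_commutator:
  "(\<lambda>x. lcoef h k x * lcoef h j (x - of_int k) - lcoef h j x * lcoef h k (x - of_int j)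
     - of_int (j - k) * lcoef h (j + k) x) \<in> O(\<lambda>x. x powi (j + k - 1))"
proof -
  define p where "p = (\<lambda>k::int. (of_int k + 1) * (h - of_int k / 2) :: real)"
  obtain q where q: "log_expansion (lcoef h k) (k + 1) (p k) (q k)" for k
    using lcoef_expansion_choice[of h] unfolding p_def by blast
  have *: "log_expansion (\<lambda>x. lcoef h k x * lcoef h j (x - of_int k)) (j + k + 2)
          (p k + (p j - of_int (j + 1) * of_int k))
          (q k + (q j + of_int k * p j - of_int (j + 1) * (of_int k)\<^sup>2 / 2))" for j k
    using log_expansion_mult[OF q[of k] log_expansion_shift[OF q[of j], of "of_int k"]]
    by (simp add: algebra_simps)
  have "(\<lambda>x. lcoef h k x * lcoef h j (x - of_int k) - lcoef h j x * lcoef h k (x - of_int j)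
     - of_int (j - k) * lcoef h (j + k) x) \<in> O(\<lambda>x. x powi (j + k + 2 - 3))"
  proof (rule log_expansion_diff3[OF *])
    show "log_expansion (\<lambda>x. lcoef h j x * lcoef h k (x - of_int j)) (j + k + 2)
          (p j + (p k - of_int (k + 1) * of_int j))
          (q j + (q k + of_int j * p k - of_int (k + 1) * (of_int j)\<^sup>2 / 2))"
      using *[of j k] by (simp add: add.commute)
    show "log_expansion (lcoef h (j + k)) (j + k + 2 - 1) (p (j + k)) (q (j + k))"
      using q[of "j + k"] by (simp add: algebra_simps)
    show "p k + (p j - of_int (j + 1) * of_int k) - (p j + (p k - of_int (k + 1) * of_int j)) = of_int (j - k)"
      by (simp add: algebra_simps)
    show "q k + (q j + of_int k * p j - of_int (j + 1) * (of_int k)\<^sup>2 / 2)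
            + (p k + (p j - of_int (j + 1) * of_int k))\<^sup>2 / 2
          - (q j + (q k + of_int j * p k - of_int (k + 1) * (of_int j)\<^sup>2 / 2)
            + (p j + (p k - of_int (k + 1) * of_int j))\<^sup>2 / 2) = of_int (j - k) * p (j + k)"
      unfolding p_def by (simp add: field_simps power2_eq_square)
  qed
  then show ?thesis by simp
qed

lemma jcoef_commutator:
  "(\<lambda>x. jcoef h k x * jcoef h j (x - of_int k) - jcoef h j x * jcoef h k (x - of_int j))
     \<in> O(\<lambda>x. x powi (j + k - 1))"
proof -
  obtain p q where q: "log_expansion (jcoef h k) k (p k) (q k)" for k
    using jcoef_expansion_choice[of h] by blast
  have *: "log_expansion (\<lambda>x. jcoef h k x * jcoef h j (x - of_int k)) (j + k)
          (p k + (p j - of_int j * of_int k))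
          (q k + (q j + of_int k * p j - of_int j * (of_int k)\<^sup>2 / 2))" for j k
    using log_expansion_mult[OF q[of k] log_expansion_shift[OF q[of j], of "of_int k"]]
    by (simp add: algebra_simps)
  show ?thesis
    using log_expansion_diff1[OF *[of k j] *[of j k, folded add.commute[of j k]]]
    by simp
qed

lemma lcoef_jcoef_commutator:
  "(\<lambda>x. jcoef h k x * lcoef h j (x - of_int k) - lcoef h j x * jcoef h k (x - of_int j)
     - (- of_int k) * jcoef h (j + k) x) \<in> O(\<lambda>x. x powi (j + k - 1))"
proof -
  obtain p q where J: "log_expansion (jcoef h k) k (p k) (q k)" for k
    using jcoef_expansion_choice[of h] by blast
  obtain p' q' where L: "log_expansion (lcoef h k) (k + 1) (p' k) (q' k)" for k
    using lcoef_expansion_choice[of h] that[of "\<lambda>k. (of_int k + 1) * (h - of_int k / 2)"] by blast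
  have "(\<lambda>x. jcoef h k x * lcoef h j (x - of_int k) - lcoef h j x * jcoef h k (x - of_int j)
     - (- of_int k) * jcoef h (j + k) x) \<in> O(\<lambda>x. x powi (j + k + 1 - 2))"
  proof (rule log_expansion_diff2)
    show "log_expansion (\<lambda>x. jcoef h k x * lcoef h j (x - of_int k)) (j + k + 1)
        (p k + (p' j - of_int (j + 1) * of_int k))
        (q k + (q' j + of_int k * p' j - of_int (j + 1) * (of_int k)\<^sup>2 / 2))"
      using log_expansion_mult[OF J[of k] log_expansion_shift[OF L[of j], of "of_int k"]]
      by (simp add: algebra_simps)
    show "log_expansion (\<lambda>x. lcoef h j x * jcoef h k (x - of_int j)) (j + k + 1)
        (p' j + (p k - of_int k * of_int j))
        (q' j + (q k + of_int j * p k - of_int k * (of_int j)\<^sup>2 / 2))"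
      using log_expansion_mult[OF L[of j] log_expansion_shift[OF J[of k], of "of_int j"]]
      by (simp add: algebra_simps)
    show "log_expansion (jcoef h (j + k)) (j + k + 1 - 1) (p (j + k)) (q (j + k))"
      using J[of "j + k"] by simp
  qed (simp add: algebra_simps)
  then show ?thesis by simp
qed

section \<open>Weighted shifts\<close>

text \<open>
  The value 0 at negative exponents lets the action of a shift on monomials be written without a case
  distinction.
\<close>
definition zpow :: "int \<Rightarrow> complex poly" where
  "zpow i = (if i \<ge> 0 then monom 1 (nat i) else 0)"

text \<open>
  The last clause is what allows weights to be multiplied under composition: if the inner operator sends
  \<open>z\<^sup>n\<close> to a negative power, so that the result is 0, its weight vanishes, although the outer weight at
  \<open>n - k < 0\<close> may be arbitrary.
\<close>
definition shift_op :: "polyop \<Rightarrow> int \<Rightarrow> (real \<Rightarrow> real) \<Rightarrow> bool" where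
  "shift_op t k f \<longleftrightarrow> lin_op t \<and> (\<forall>n. t (monom 1 n) = smult (of_real (f (real n))) (zpow (int n - k))) \<and>
     (\<forall>n. int n < k \<longrightarrow> f (real n) = 0)"

lemma lin_op_iff: "lin_op A \<longleftrightarrow> (\<forall>p q. A (p + q) = A p + A q) \<and> (\<forall>c p. A (smult c p) = smult c (A p))"
  unfolding lin_op_def
  by (auto simp: Vector_Spaces.linear_iff vector_space_def smult_add_left smult_add_right)

lemma lin_op_zero: "lin_op A \<Longrightarrow> A 0 = 0"
  by (metis lin_op_iff smult_0_left)

lemma lin_op_sum: "lin_op A \<Longrightarrow> A (\<Sum>i\<in>S. g i) = (\<Sum>i\<in>S. A (g i))"
  by (induction S rule: infinite_finite_induct) (auto simp: lin_op_zero lin_op_iff)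

lemma lin_op_comp: "lin_op A \<Longrightarrow> lin_op B \<Longrightarrow> lin_op (A \<circ> B)"
  by (auto simp: lin_op_iff)

lemma smult_sum_right: "smult c (\<Sum>i\<in>S. g i) = (\<Sum>i\<in>S. smult c (g i))"
proof (induction S rule: infinite_finite_induct)
  case (insert x F)
  then show ?case by (simp add: smult_add_right)
qed simp_all

lemma lin_op_lincomb:
  assumes "\<And>i. i \<in> S \<Longrightarrow> lin_op (A i)"
  shows "lin_op (\<lambda>p. \<Sum>i\<in>S. smult (c i) (A i p))"
  unfolding lin_op_iff
proof (intro conjI allI)
  fix p q d
  have "(\<Sum>i\<in>S. smult (c i) (A i (p + q))) = (\<Sum>i\<in>S. smult (c i) (A i p) + smult (c i) (A i q))"
    using assms by (intro sum.cong) (simp_all add: lin_op_iff smult_add_right)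
  then show "(\<Sum>i\<in>S. smult (c i) (A i (p + q))) = (\<Sum>i\<in>S. smult (c i) (A i p)) + (\<Sum>i\<in>S. smult (c i) (A i q))"
    by (simp add: sum.distrib)
  show "(\<Sum>i\<in>S. smult (c i) (A i (smult d p))) = smult d (\<Sum>i\<in>S. smult (c i) (A i p))"
    unfolding smult_sum_right
  proof (rule sum.cong)
    fix i assume "i \<in> S"
    then have "A i (smult d p) = smult d (A i p)"
      using assms by (simp add: lin_op_iff)
    then show "smult (c i) (A i (smult d p)) = smult d (smult (c i) (A i p))"
      by (simp add: mult.commute)
  qed simp
qed

lemma poly_monom_expansion: "(p :: complex poly) = (\<Sum>i\<le>degree p. smult (coeff p i) (monom 1 i))"
proof -
  have "p = (\<Sum>i\<le>degree p. monom (coeff p i) i)"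
    by (rule poly_as_sum_of_monoms [symmetric])
  also have "\<dots> = (\<Sum>i\<le>degree p. smult (coeff p i) (monom 1 i))"
    by (simp only: smult_monom mult_1_right)
  finally show ?thesis .
qed

lemma shift_opD: "shift_op t k f \<Longrightarrow> t (monom 1 n) = smult (of_real (f (real n))) (zpow (int n - k))"
  by (simp add: shift_op_def)

lemma shift_op_id: "shift_op id 0 (\<lambda>_. 1)"
  by (simp add: shift_op_def lin_op_iff zpow_def)

lemma shift_op_comp:
  assumes s: "shift_op s j f" and t: "shift_op t k g"
  shows "shift_op (s \<circ> t) (j + k) (\<lambda>x. g x * f (x - of_int k))"
  unfolding shift_op_def
proof (intro conjI allI impI)
  show "lin_op (s \<circ> t)"
    using assms by (auto simp: shift_op_def lin_op_comp)
  have smult: "s (smult c p) = smult c (s p)" for c p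
    using s by (simp add: shift_op_def lin_op_iff)
  fix n
  show "(s \<circ> t) (monom 1 n) = smult (of_real (g (real n) * f (real n - of_int k))) (zpow (int n - (j + k)))"
  proof (cases "int n < k")
    case True
    then have "g (real n) = 0" using t by (simp add: shift_op_def)
    then show ?thesis using smult[of 0 0] by (simp add: shift_opD[OF t])
  next
    case False
    then have "real n - of_int k = real (nat (int n - k))" by simp
    then show ?thesis
      using False by (simp add: shift_opD[OF t] smult shift_opD[OF s] zpow_def[of "int n - k"] algebra_simps)
  qed
  assume n: "int n < j + k"
  show "g (real n) * f (real n - of_int k) = 0"
  proof (cases "int n < k")
    case True
    then show ?thesis using t by (simp add: shift_op_def)
  next
    case False
    then have "real n - of_int k = real (nat (int n - k))" "int (nat (int n - k)) < j" using n by auto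
    moreover from this(2) have "f (real (nat (int n - k))) = 0" using s by (simp only: shift_op_def)
    ultimately show ?thesis by (simp only: mult_zero_right)
  qed
qed

lemma shift_op_diff:
  assumes "shift_op s k f" "shift_op t k g"
  shows "shift_op (\<lambda>p. s p - t p) k (\<lambda>x. f x - g x)"
proof -
  have "lin_op (\<lambda>p. s p - t p)"
    using assms by (simp add: shift_op_def lin_op_iff smult_diff_right)
  with assms show ?thesis
    by (simp add: shift_op_def smult_diff_left)
qed

lemma shift_op_smult:
  assumes "shift_op s k f"
  shows "shift_op (\<lambda>p. smult (of_real c) (s p)) k (\<lambda>x. c * f x)"
proof -
  have "lin_op (\<lambda>p. smult (of_real c) (s p))"
    using assms by (simp add: shift_op_def lin_op_iff smult_add_right mult.commute)
  with assms show ?thesis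
    by (simp add: shift_op_def)
qed

lemma shift_op_funpow:
  assumes "shift_op t k f"
  shows "shift_op (t ^^ m) (int m * k) (\<lambda>x. \<Prod>i<m. f (x - of_int (int i * k)))"
proof (induction m)
  case 0
  show ?case using shift_op_id by (simp add: id_def)
next
  case (Suc m)
  show ?case
    using shift_op_comp[OF assms Suc] by (simp add: algebra_simps comp_def)
qed

lemma coeff_xi_fun: "coeff (xi_fun f p) n = f (of_nat n) * coeff p n"
proof -
  have "coeff (xi_fun f p) n = (\<Sum>m\<le>degree p. if m = n then f (of_nat m) * coeff p m else 0)"
    by (simp add: xi_fun_def coeff_sum)
  then show ?thesis
    by (simp add: sum.delta coeff_eq_0)
qed

lemma shift_op_xi_fun:
  assumes "\<And>n. f (of_nat n) = of_real (g (real n))"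
  shows "shift_op (xi_fun f) 0 g"
proof -
  have "xi_fun f (p + q) = xi_fun f p + xi_fun f q" "xi_fun f (smult c p) = smult c (xi_fun f p)" for p q c
    by (rule poly_eqI, simp add: coeff_xi_fun distrib_left mult.left_commute)+
  moreover have "xi_fun f (monom 1 n) = smult (of_real (g (real n))) (zpow (int n - 0))" for n
    by (rule poly_eqI) (simp add: coeff_xi_fun zpow_def assms)
  ultimately show ?thesis
    by (simp add: shift_op_def lin_op_iff)
qed

lemma shift_op_monom_mult: "shift_op (\<lambda>p. monom 1 m * p) (- int m) (\<lambda>_. 1)"
proof -
  have "nat (int n - - int m) = m + n" for n
    by simp
  then show ?thesis
    by (simp add: shift_op_def lin_op_iff zpow_def mult_monom distrib_left)
qed

lemma shift_op_pderiv: "shift_op pderiv 1 (\<lambda>x. x)"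
proof -
  have "pderiv (monom 1 n) = smult (of_nat n) (zpow (int n - 1))" for n
    by (cases n) (simp_all add: zpow_def pderiv_monom smult_monom)
  then show ?thesis
    by (auto simp: shift_op_def lin_op_iff pderiv_add pderiv_smult)
qed

lemma shift_op_zero: "shift_op (\<lambda>p. 0) k (\<lambda>_. 0)"
  by (simp add: shift_op_def lin_op_iff)

lemma shift_op_commutator:
  assumes "shift_op s j f" "shift_op t k g"
  shows "shift_op (commutator s t) (j + k) (\<lambda>x. g x * f (x - of_int k) - f x * g (x - of_int j))"
proof -
  have "shift_op (t \<circ> s) (j + k) (\<lambda>x. f x * g (x - of_int j))"
    using shift_op_comp[OF assms(2,1)] by (simp add: add.commute)
  from shift_op_diff[OF shift_op_comp[OF assms] this] show ?thesis
    by (simp add: commutator_def [abs_def] comp_def)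
qed

lemma shift_op_J: "shift_op (J_op h k) k (jcoef h k)"
proof (cases "k \<ge> 0")
  case True
  show ?thesis
    using shift_op_funpow[OF shift_op_pderiv, of "nat k"] True
    by (simp add: J_op_def jcoef_def [abs_def])
next
  case False
  have "shift_op (xi_fun (\<lambda>x. 1 / (x + 2 * of_real h))) 0 (\<lambda>x. 1 / (x + 2 * h))"
    by (rule shift_op_xi_fun) simp
  from shift_op_comp[OF shift_op_monom_mult[of 1] this]
  have "shift_op (F_op h) (- 1) (\<lambda>x. 1 / (x + 2 * h))"
    by (simp add: F_op_def [abs_def] comp_def monom_altdef)
  from shift_op_funpow[OF this, of "nat (- k)"] show ?thesis
    using False by (simp add: J_op_def jcoef_def [abs_def] add_ac)
qed

lemma shift_op_L: "shift_op (L_op h k) k (lcoef h k)"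
proof (cases "k \<ge> 0")
  case True
  have "shift_op (xi_fun (\<lambda>x. x + (of_int k + 1) * of_real h)) 0 (\<lambda>x. x + (of_int k + 1) * h)"
    by (rule shift_op_xi_fun) simp
  from shift_op_comp[OF this shift_op_funpow[OF shift_op_pderiv, of "nat k"]] show ?thesis
    using True by (simp add: L_op_def lcoef_def [abs_def] jcoef_def [abs_def] comp_def algebra_simps)
next
  case False
  have "shift_op (xi_fun (\<lambda>x. (x + (of_int (- k) + 1) * of_real h) / pochhammer (x + 2 * of_real h) (nat (- k)))) 0
          (\<lambda>x. (x + (1 - of_int k) * h) * (\<Prod>i<nat (- k). 1 / (x + (2 * h + real i))))"
    by (rule shift_op_xi_fun) (simp add: pochhammer_prod prod_dividef add_ac atLeast0LessThan)
  from shift_op_comp[OF shift_op_monom_mult[of "nat (- k)"] this] show ?thesis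
    using False by (simp add: L_op_def lcoef_def [abs_def] jcoef_def [abs_def] comp_def)
qed

section \<open>Unitary structures on Verma modules\<close>

context
  fixes h :: real and ip :: polyform
  assumes unitary: "unitary_structure h ip"
begin

lemma ip_cnj: "ip p q = cnj (ip q p)"
  and ip_add_left: "ip (p + q) r = ip p r + ip q r"
  and ip_smult_left: "ip (smult c p) q = c * ip p q"
  and ip_pos: "p \<noteq> 0 \<Longrightarrow> Re (ip p p) > 0"
  using unitary unfolding unitary_structure_def pre_hilbert_def by blast+

lemma ip_add_right: "ip p (q + r) = ip p q + ip p r"
  by (metis ip_cnj ip_add_left complex_cnj_add)

lemma ip_smult_right: "ip p (smult c q) = cnj c * ip p q"
  by (metis ip_cnj ip_smult_left complex_cnj_mult)

lemma ip_zero_left [simp]: "ip 0 q = 0"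
  using ip_smult_left[of 0 0 q] by simp

lemma ip_zero_right [simp]: "ip q 0 = 0"
  using ip_smult_right[of q 0 0] by simp

lemma ip_sum_left: "ip (\<Sum>i\<in>S. f i) q = (\<Sum>i\<in>S. ip (f i) q)"
  by (induction S rule: infinite_finite_induct) (simp_all add: ip_add_left)

lemma ip_sum_right: "ip q (\<Sum>i\<in>S. f i) = (\<Sum>i\<in>S. ip q (f i))"
  by (induction S rule: infinite_finite_induct) (simp_all add: ip_add_right)

lemma ip_nonneg: "Re (ip p p) \<ge> 0"
  using ip_pos[of p] by (cases "p = 0") auto

definition wt :: "nat \<Rightarrow> real" where
  "wt n = Re (ip (monom 1 n) (monom 1 n))"

lemma wt_pos: "wt n > 0"
  by (simp add: wt_def ip_pos)

text \<open>
  Different monomials are eigenvectors of the symmetric operator \<open>l\<^sub>0\<close> with different eigenvalues.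
\<close>
lemma ip_monom: "ip (monom 1 n) (monom 1 m) = (if n = m then of_real (wt n) else 0)"
proof (cases "n = m")
  case True
  have "ip (monom 1 n) (monom 1 n) \<in> \<real>"
    by (metis ip_cnj Reals_cnj_iff)
  with True show ?thesis by (simp add: wt_def)
next
  case False
  have l0: "verma_l0 h (monom 1 n) = smult (of_real (real n + h)) (monom 1 n)" for n
    by (cases n) (auto intro!: poly_eqI simp: verma_l0_def xi_def pderiv_monom algebra_simps coeff_pCons
        split: nat.splits)
  have "ip (verma_l0 h (monom 1 n)) (monom 1 m) = ip (monom 1 n) (verma_l0 h (monom 1 m))"
    using unitary by (simp add: unitary_structure_def is_adjoint_def)
  with False show ?thesis
    by (simp add: l0 ip_smult_left ip_smult_right)
qed

lemma wt_Suc: "wt (Suc n) = (real n + 1) * (real n + 2 * h) * wt n"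
proof -
  have l1: "verma_l1 h (monom 1 (Suc n)) = smult (of_real ((real n + 1) * (real n + 2 * h))) (monom 1 n)"
    by (cases n) (auto intro!: poly_eqI simp: verma_l1_def pderiv_monom algebra_simps coeff_pCons split: nat.splits)
  have "ip (verma_lm1 (monom 1 n)) (monom 1 (Suc n)) = ip (monom 1 n) (verma_l1 h (monom 1 (Suc n)))"
    using unitary by (simp add: unitary_structure_def is_adjoint_def)
  moreover have "verma_lm1 (monom 1 n) = monom 1 (Suc n)"
    by (simp add: verma_lm1_def monom_Suc)
  ultimately have "complex_of_real (wt (Suc n)) = of_real ((real n + 1) * (real n + 2 * h) * wt n)"
    by (simp add: l1 ip_smult_right ip_monom)
  then show ?thesis by (simp only: of_real_eq_iff)
qed

lemma h_pos: "h > 0"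
  using wt_pos[of "Suc 0"] wt_pos[of 0] by (simp add: wt_Suc zero_less_mult_iff)

lemma wt_add: "wt (m + k) = wt m * (\<Prod>i<k. real m + 1 + real i) * (\<Prod>i<k. real m + (2 * h + real i))"
  by (induction k) (simp_all add: wt_Suc algebra_simps)

lemma jcoef_nat: "jcoef h (int k) (real (m + k)) = (\<Prod>i<k. real m + 1 + real i)"
proof -
  have "jcoef h (int k) (real (m + k)) = (\<Prod>i<k. real (m + k) - real i)"
    by (simp add: jcoef_def)
  also have "\<dots> = (\<Prod>i<k. real (m + k) - real (k - Suc i))"
    by (rule prod.nat_diff_reindex [symmetric])
  also have "\<dots> = (\<Prod>i<k. real m + 1 + real i)"
    by (rule prod.cong) (auto simp: of_nat_diff)
  finally show ?thesis .
qed

lemma jcoef_nat_pos: "jcoef h (int k) (real (m + k)) > 0"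
  unfolding jcoef_nat by (rule prod_pos) simp

lemma jcoef_neg: "jcoef h (- int k) x = (\<Prod>i<k. 1 / (x + (2 * h + real i)))"
  by (cases "k = 0") (simp_all add: jcoef_def)

lemma jcoef_neg_pos: "jcoef h (- int k) (real m) > 0"
  unfolding jcoef_neg using h_pos by (intro prod_pos) (simp add: add_nonneg_pos add_pos_nonneg)

lemma jcoef_wt_nat: "jcoef h (int k) (real (m + k)) * wt m = jcoef h (- int k) (real m) * wt (m + k)"
proof -
  have "(\<Prod>i<k. 1 / (real m + (2 * h + real i))) * (\<Prod>i<k. real m + (2 * h + real i)) = 1"
    unfolding prod.distrib [symmetric] using h_pos
    by (intro prod.neutral ballI) (simp add: add_nonneg_pos add_pos_nonneg less_imp_neq [symmetric])
  then show ?thesis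
    unfolding jcoef_nat jcoef_neg wt_add by (simp add: algebra_simps)
qed

text \<open>
  Multiplying a weight by a ratio of squared norms gives the weight of the adjoint shift, so this is the
  relation \<open>J\<^sub>k\<^sup>* = J\<^bsub>-k\<^esub>\<close> on monomials.
\<close>
lemma jcoef_wt:
  assumes "int n \<ge> k"
  shows "jcoef h k (real n) * wt (nat (int n - k)) = jcoef h (- k) (real n - of_int k) * wt n"
proof (cases "k \<ge> 0")
  case True
  define m where "m = nat (int n - k)"
  have "n = m + nat k" "k = int (nat k)" using assms True by (simp_all add: m_def)
  then show ?thesis
    using jcoef_wt_nat[of "nat k" m] unfolding m_def [symmetric]
    by (metis add_diff_cancel_right' of_int_of_nat_eq of_nat_add)
next
  case False
  then have "nat (int n - k) = n + nat (- k)" "- k = int (nat (- k))" "k = - int (nat (- k))"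
    "real n - of_int k = real (n + nat (- k))"
    by simp_all
  then show ?thesis
    using jcoef_wt_nat[of "nat (- k)" n] by metis
qed

text \<open>
  The linear factor by which the weight of \<open>L\<^sub>k\<close> differs from that of \<open>J\<^sub>k\<close> is the same at \<open>(k, n)\<close> and
  at \<open>(-k, n - k)\<close>.
\<close>
lemma lcoef_wt:
  assumes "int n \<ge> k"
  shows "lcoef h k (real n) * wt (nat (int n - k)) = lcoef h (- k) (real n - of_int k) * wt n"
proof -
  have "real n + (if k \<ge> 0 then (of_int k + 1) * h - of_int k else (1 - of_int k) * h)
      = real n - of_int k + (if - k \<ge> 0 then (of_int (- k) + 1) * h - of_int (- k) else (1 - of_int (- k)) * h)"
    by (auto simp: algebra_simps)
  then show ?thesis
    unfolding lcoef_def using jcoef_wt[OF assms] by (simp only: mult.assoc)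
qed

lemma is_adjoint_lincomb:
  assumes "\<And>i. i \<in> S \<Longrightarrow> is_adjoint ip (A i) (B i)"
  shows "is_adjoint ip (\<lambda>p. \<Sum>i\<in>S. smult (c i) (A i p)) (\<lambda>p. \<Sum>i\<in>S. smult (cnj (c i)) (B i p))"
  unfolding is_adjoint_def ip_sum_left ip_sum_right ip_smult_left ip_smult_right
  using assms by (auto intro!: sum.cong simp: is_adjoint_def)

lemma is_adjoint_monomI:
  assumes "lin_op s" "lin_op t"
    and m: "\<And>m n. ip (s (monom 1 n)) (monom 1 m) = ip (monom 1 n) (t (monom 1 m))"
  shows "is_adjoint ip s t"
  unfolding is_adjoint_def
proof (intro allI)
  fix p q :: "complex poly"
  have s: "s (smult c r) = smult c (s r)" and t: "t (smult c r) = smult c (t r)" for c r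
    using assms by (simp_all add: lin_op_iff)
  have "ip (s p) q = ip (s (\<Sum>i\<le>degree p. smult (coeff p i) (monom 1 i))) (\<Sum>j\<le>degree q. smult (coeff q j) (monom 1 j))"
    using poly_monom_expansion by metis
  also have "\<dots> = ip (\<Sum>i\<le>degree p. smult (coeff p i) (monom 1 i)) (t (\<Sum>j\<le>degree q. smult (coeff q j) (monom 1 j)))"
    by (simp only: lin_op_sum[OF assms(1)] lin_op_sum[OF assms(2)] ip_sum_left ip_sum_right s t
        ip_smult_left ip_smult_right m)
  also have "\<dots> = ip p (t q)"
    using poly_monom_expansion by metis
  finally show "ip (s p) q = ip p (t q)" .
qed

lemma shift_op_adjoint:
  assumes s: "shift_op s k f" and t: "shift_op t (- k) g"
    and fg: "\<And>n. int n \<ge> k \<Longrightarrow> f (real n) * wt (nat (int n - k)) = g (real n - of_int k) * wt n"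
  shows "is_adjoint ip s t"
proof (rule is_adjoint_monomI)
  fix m n
  have *: "ip (s (monom 1 n)) (monom 1 m) = of_real (f (real n)) * ip (zpow (int n - k)) (monom 1 m)"
      "ip (monom 1 n) (t (monom 1 m)) = of_real (g (real m)) * ip (monom 1 n) (zpow (int m + k))"
    by (simp_all add: shift_opD[OF s] shift_opD[OF t] ip_smult_left ip_smult_right)
  show "ip (s (monom 1 n)) (monom 1 m) = ip (monom 1 n) (t (monom 1 m))"
  proof (cases "int n - k = int m")
    case True
    then have "int m + k = int n" "k \<le> int n" "real n - of_int k = real m" "nat (int n - k) = m" by linarith+
    then have "f (real n) * wt m = g (real m) * wt n"
      using fg[of n] by metis
    then show ?thesis
      unfolding * True \<open>int m + k = int n\<close> by (simp add: zpow_def ip_monom flip: of_real_mult)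
  next
    case False
    then have "ip (zpow (int n - k)) (monom 1 m) = 0" "ip (monom 1 n) (zpow (int m + k)) = 0"
      by (auto simp: zpow_def ip_monom)
    then show ?thesis unfolding * by simp
  qed
qed (use s t in \<open>simp_all add: shift_op_def\<close>)

section \<open>Hilbert-Schmidt operators\<close>

text \<open>
  Finiteness of the Hilbert-Schmidt norm, computed in the orthonormal basis of normalized monomials. The
  basis in the definition of a Hilbert-Schmidt operator may depend on the operator; fixing it makes linear
  combinations accessible.
\<close>
definition hs_summable :: "polyop \<Rightarrow> bool" where
  "hs_summable A \<longleftrightarrow> summable (\<lambda>n. Re (ip (A (monom 1 n)) (A (monom 1 n))) / wt n)"

text \<open>
  By the parallelogram law \<open>\<parallel>a + b\<parallel>\<^sup>2 \<le> 2\<parallel>a\<parallel>\<^sup>2 + 2\<parallel>b\<parallel>\<^sup>2\<close>.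
\<close>
lemma hs_summable_add:
  assumes "hs_summable A" "hs_summable B"
  shows "hs_summable (\<lambda>p. A p + B p)"
  unfolding hs_summable_def
proof (rule summable_comparison_test')
  show "summable (\<lambda>n. 2 * (Re (ip (A (monom 1 n)) (A (monom 1 n))) / wt n) +
            2 * (Re (ip (B (monom 1 n)) (B (monom 1 n))) / wt n))"
    using assms unfolding hs_summable_def by (intro summable_add summable_mult)
  fix n
  have "Re (ip (p + q) (p + q)) \<le> 2 * Re (ip p p) + 2 * Re (ip q q)" for p q
  proof -
    have "Re (ip (p + q) (p + q)) + Re (ip (p + smult (- 1) q) (p + smult (- 1) q))
        = 2 * Re (ip p p) + 2 * Re (ip q q)"
      unfolding ip_add_left ip_add_right ip_smult_left ip_smult_right by simp
    then show ?thesis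
      using ip_nonneg[of "p + smult (- 1) q"] by linarith
  qed
  then show "norm (Re (ip (A (monom 1 n) + B (monom 1 n)) (A (monom 1 n) + B (monom 1 n))) / wt n)
     \<le> 2 * (Re (ip (A (monom 1 n)) (A (monom 1 n))) / wt n) +
            2 * (Re (ip (B (monom 1 n)) (B (monom 1 n))) / wt n)"
    using wt_pos[of n] by (simp add: ip_nonneg divide_right_mono flip: add_divide_distrib)
qed

lemma hs_summable_smult:
  assumes "hs_summable A"
  shows "hs_summable (\<lambda>p. smult c (A p))"
proof -
  have "Re (ip (smult c p) (smult c p)) = (cmod c)\<^sup>2 * Re (ip p p)" for p
  proof -
    have "ip (smult c p) (smult c p) = complex_of_real ((cmod c)\<^sup>2) * ip p p"
      unfolding complex_norm_square by (simp add: ip_smult_left ip_smult_right)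
    then show ?thesis by (simp del: of_real_power)
  qed
  then show ?thesis
    using assms by (simp add: hs_summable_def summable_mult flip: times_divide_eq_right)
qed

lemma hs_summable_lincomb:
  assumes "finite S" "\<And>i. i \<in> S \<Longrightarrow> hs_summable (A i)"
  shows "hs_summable (\<lambda>p. \<Sum>i\<in>S. smult (c i) (A i p))"
  using assms
proof (induction S)
  case empty
  then show ?case by (simp add: hs_summable_def)
next
  case (insert i S)
  then show ?case by (simp add: hs_summable_add hs_summable_smult)
qed

text \<open>
  The summands are \<open>f(n)\<^sup>2 w(n-k)/w(n)\<close>. The growth of the ratio of squared norms need not be computed
  separately: by the adjointness of \<open>J\<^sub>k\<close> and \<open>J\<^bsub>-k\<^esub>\<close> it is the quotient of the weights of \<open>J\<^bsub>-k\<^esub>\<close> at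
  \<open>n - k\<close> and of \<open>J\<^sub>k\<close> at \<open>n\<close>, whose orders are \<open>-k\<close> and \<open>k\<close>.
\<close>
lemma hs_summable_shift:
  assumes t: "shift_op t k f" and f: "f \<in> O(\<lambda>x. x powi (k - 1))"
  shows "hs_summable t"
proof -
  have J: "jcoef h k \<in> \<Theta>(\<lambda>x. x powi k)" for k
    using jcoef_expansion log_expansion_bigtheta by blast
  have J': "(\<lambda>x. jcoef h (- k) (x - of_int k)) \<in> \<Theta>(\<lambda>x. x powi (- k))"
    using jcoef_expansion[of h "- k"] log_expansion_shift log_expansion_bigtheta by blast
  have nz: "\<forall>\<^sub>F x::real in at_top. x powi k \<noteq> 0" for k
    using eventually_gt_at_top[of 0] by eventually_elim simp
  have "(\<lambda>x. f x * f x * (jcoef h (- k) (x - of_int k) / jcoef h k x))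
          \<in> O(\<lambda>x. x powi (k - 1) * x powi (k - 1) * (x powi (- k) / x powi k))"
  proof (intro landau_o.big.mult landau_o.big.divide f)
    show "\<forall>\<^sub>F x in at_top. jcoef h k x \<noteq> 0" "\<forall>\<^sub>F x in at_top. (x::real) powi k \<noteq> 0"
      using eventually_nonzero_bigtheta[OF J[of k]] nz[of k] by blast+
  qed (use J[of k] J' in \<open>auto simp: bigtheta_def bigomega_iff_bigo\<close>)
  also have "O(\<lambda>x. x powi (k - 1) * x powi (k - 1) * (x powi (- k) / x powi k)) = O(\<lambda>x::real. 1 / x ^ 2)"
  proof (rule landau_o.big.cong)
    show "\<forall>\<^sub>F x::real in at_top. x powi (k - 1) * x powi (k - 1) * (x powi (- k) / x powi k) = 1 / x ^ 2"
      using eventually_gt_at_top[of 0]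
      by eventually_elim (simp add: power_int_diff power_int_minus power2_eq_square divide_simps)
  qed
  finally have "(\<lambda>x. f x * f x * (jcoef h (- k) (x - of_int k) / jcoef h k x)) \<in> O(\<lambda>x. 1 / x ^ 2)" .
  then have 1: "(\<lambda>n. f (real n) * f (real n) * (jcoef h (- k) (real n - of_int k) / jcoef h k (real n)))
      \<in> O(\<lambda>n. 1 / real n ^ 2)"
    by (rule landau_o.big.compose[OF _ filterlim_real_sequentially])
  have "\<forall>\<^sub>F n in sequentially. Re (ip (t (monom 1 n)) (t (monom 1 n))) / wt n
     = f (real n) * f (real n) * (jcoef h (- k) (real n - of_int k) / jcoef h k (real n))"
    using eventually_ge_at_top[of "nat k"]
  proof eventually_elim
    case (elim n)
    then have n: "int n \<ge> k" by simp
    have "jcoef h k (real n) > 0"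
    proof (cases "k \<ge> 0")
      case True
      then show ?thesis using n jcoef_nat_pos[of "nat k" "n - nat k"] by simp
    next
      case False
      then show ?thesis using jcoef_neg_pos[of "nat (- k)" n] by simp
    qed
    then have "wt (nat (int n - k)) / wt n = jcoef h (- k) (real n - of_int k) / jcoef h k (real n)"
      using jcoef_wt[OF n] wt_pos[of n] by (simp add: frac_eq_eq mult.commute)
    moreover have "Re (ip (t (monom 1 n)) (t (monom 1 n))) = f (real n) * f (real n) * wt (nat (int n - k))"
      using n by (simp add: shift_opD[OF t] zpow_def ip_smult_left ip_smult_right ip_monom)
    ultimately show ?case
      by (metis times_divide_eq_right)
  qed
  from landau_o.big.in_cong[OF this] 1
  have "(\<lambda>n. Re (ip (t (monom 1 n)) (t (monom 1 n))) / wt n) \<in> O(\<lambda>n. 1 / real n ^ 2)"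
    by blast
  moreover have "summable (\<lambda>n. norm (1 / real n ^ 2))"
    using inverse_power_summable[of 2, where 'a = real] by (simp add: inverse_eq_divide)
  ultimately show ?thesis
    unfolding hs_summable_def by (rule summable_comparison_test_bigo[rotated])
qed

text \<open>
  The images of the normalized monomials form an orthonormal basis of the completion, because
  polynomials are dense; the operator determined by its values on them extends \<open>A\<close>.
\<close>
lemma hs_summable_imp_HS_ops:
  fixes \<iota> :: "complex poly \<Rightarrow> 'h::chilbert_space"
  assumes completion: "is_completion ip \<iota>" and A: "lin_op A" "hs_summable A"
  shows "A \<in> HS_ops \<iota>"
proof -
  have \<iota>_add: "\<iota> (p + q) = \<iota> p + \<iota> q" and \<iota>_smult: "\<iota> (smult c p) = scaleC c (\<iota> p)"
    and cinner_\<iota>: "cinner (\<iota> p) (\<iota> q) = ip p q" and dense: "closure (range \<iota>) = UNIV" for p q c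
    using completion by (simp_all add: is_completion_def)
  have \<iota>_0: "\<iota> 0 = 0"
    using \<iota>_add[of 0 0] by simp
  have \<iota>_sum: "\<iota> (\<Sum>i\<in>S. g i) = (\<Sum>i\<in>S. \<iota> (g i))" for g :: "nat \<Rightarrow> complex poly" and S
    by (induction S rule: infinite_finite_induct) (simp_all add: \<iota>_0 \<iota>_add)
  have A_smult: "A (smult c p) = smult c (A p)" for c p
    using A(1) by (simp add: lin_op_iff)
  define b :: "nat \<Rightarrow> complex poly" where "b = (\<lambda>n. smult (of_real (1 / sqrt (wt n))) (monom 1 n))"
  have monom_b: "monom 1 n = smult (of_real (sqrt (wt n))) (b n)" for n
    using wt_pos[of n] by (simp add: b_def flip: of_real_mult)
  have on: "cinner (\<iota> (b m)) (\<iota> (b n)) = (if m = n then 1 else 0)" for m n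
    using wt_pos[of n]
    by (simp add: cinner_\<iota> b_def ip_smult_left ip_smult_right ip_monom flip: of_real_mult)
  have poly_b: "p = (\<Sum>i\<le>degree p. smult (coeff p i * of_real (sqrt (wt i))) (b i))" for p
    by (subst poly_monom_expansion[of p]) (simp add: monom_b)
  have "(norm (\<iota> (A (b n))))\<^sup>2 = Re (ip (A (monom 1 n)) (A (monom 1 n))) / wt n" for n
    using wt_pos[of n]
    by (simp add: power2_norm_eq_inner inner_eq_Re_cinner cinner_\<iota> b_def A_smult ip_smult_left
        ip_smult_right flip: of_real_mult)
  then have sm: "summable (\<lambda>n. (norm (\<iota> (A (b n))))\<^sup>2)"
    using A(2) by (simp add: hs_summable_def)
  obtain B where B: "bounded_linear B" "\<And>c x. B (scaleC c x) = scaleC c (B x)" "\<And>n. B (\<iota> (b n)) = \<iota> (A (b n))"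
    using orthonormal_sequence_operator[OF on sm] by metis
  interpret B: bounded_linear B by (rule B(1))
  have B\<iota>: "B (\<iota> p) = \<iota> (A p)" for p
  proof -
    have "B (\<iota> p) = B (\<iota> (\<Sum>i\<le>degree p. smult (coeff p i * of_real (sqrt (wt i))) (b i)))"
      using poly_b by metis
    also have "\<dots> = \<iota> (A (\<Sum>i\<le>degree p. smult (coeff p i * of_real (sqrt (wt i))) (b i)))"
      by (simp only: \<iota>_sum B.sum \<iota>_smult B(2,3) lin_op_sum[OF A(1)] A_smult)
    also have "\<dots> = \<iota> (A p)"
      using poly_b by metis
    finally show ?thesis .
  qed
  have inj: "inj (\<lambda>n. \<iota> (b n))"
  proof (rule injI)
    fix m n assume "\<iota> (b m) = \<iota> (b n)"
    then show "m = n" using on[of m n] on[of n n] by (auto split: if_splits)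
  qed
  have "orthonormal_basis (range (\<lambda>n. \<iota> (b n)))"
    unfolding orthonormal_basis_def
  proof (intro conjI ballI allI impI)
    fix e f assume "e \<in> range (\<lambda>n. \<iota> (b n))" "f \<in> range (\<lambda>n. \<iota> (b n))"
    then show "cinner e f = (if e = f then 1 else 0)"
      using on injD[OF inj] by (auto split: if_splits)
  next
    fix x assume x: "\<forall>e\<in>range (\<lambda>n. \<iota> (b n)). cinner x e = 0"
    have "inner x (\<iota> p) = 0" for p
    proof -
      have "cinner (\<iota> p) x = cinner (\<iota> (\<Sum>i\<le>degree p. smult (coeff p i * of_real (sqrt (wt i))) (b i))) x"
        using poly_b by metis
      also have "\<dots> = 0"
        unfolding \<iota>_sum \<iota>_smult cinner_sum_left cinner_scaleC_left
        using x by (simp add: cinner_commute[of _ x])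
      finally show ?thesis
        by (metis inner_commute inner_eq_Re_cinner zero_complex.sel(1))
    qed
    then have "range \<iota> \<subseteq> {y. inner x y = 0}" by auto
    moreover have "closed {y. inner x y = 0}"
      by (intro closed_Collect_eq continuous_intros)
    ultimately have "closure (range \<iota>) \<subseteq> {y. inner x y = 0}"
      by (rule closure_minimal)
    then have "x \<in> {y. inner x y = 0}" using dense by blast
    then show "x = 0" by simp
  qed
  moreover have "(\<lambda>e. (norm (B e))\<^sup>2) summable_on range (\<lambda>n. \<iota> (b n))"
    unfolding summable_on_reindex[OF inj] comp_def B(3)
    using sm by (simp add: summable_on_UNIV_nonneg_real_iff)
  ultimately have "hilbert_schmidt B"
    unfolding hilbert_schmidt_def using B(1,2) by blast
  then show ?thesis
    unfolding HS_ops_def using A(1) B\<iota> by blast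
qed

end

section \<open>Linear extension from a basis\<close>

lemma op_ext_superset:
  assumes "finite S" "Poly_Mapping.keys X \<subseteq> S"
  shows "op_ext t X p = (\<Sum>i\<in>S. smult (Poly_Mapping.lookup X i) (t i p))"
  unfolding op_ext_def using assms
  by (intro sum.mono_neutral_left) (auto simp: in_keys_iff)

lemma op_ext_single [simp]: "op_ext t (Poly_Mapping.single i a) = (\<lambda>p. smult a (t i p))"
proof
  show "op_ext t (Poly_Mapping.single i a) p = smult a (t i p)" for p
    by (subst op_ext_superset[of "{i}"]) (auto split: if_splits)
qed

lemma op_ext_zero [simp]: "op_ext t 0 = (\<lambda>p. 0)"
  by (simp add: op_ext_def [abs_def])

lemma op_ext_add: "op_ext t (X + Y) p = op_ext t X p + op_ext t Y p"
proof -
  define S where "S = Poly_Mapping.keys X \<union> Poly_Mapping.keys Y"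
  have S: "finite S" "Poly_Mapping.keys X \<subseteq> S" "Poly_Mapping.keys Y \<subseteq> S" "Poly_Mapping.keys (X + Y) \<subseteq> S"
    using keys_add[of X Y] by (auto simp: S_def)
  show ?thesis
    unfolding S(2)[THEN op_ext_superset[OF S(1)]] S(3)[THEN op_ext_superset[OF S(1)]]
      S(4)[THEN op_ext_superset[OF S(1)]]
    by (simp add: lookup_add smult_add_left sum.distrib)
qed

lemma op_ext_sum: "op_ext t (\<Sum>i\<in>S. X i) p = (\<Sum>i\<in>S. op_ext t (X i) p)"
  by (induction S rule: infinite_finite_induct) (simp_all add: op_ext_add)

lemma op_ext_pscale: "op_ext t (pscale c X) p = smult c (op_ext t X p)"
proof -
  have "Poly_Mapping.keys (pscale c X) \<subseteq> Poly_Mapping.keys X"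
    by (auto simp: in_keys_iff)
  from op_ext_superset[OF finite_keys this] show ?thesis
    by (simp add: op_ext_def smult_sum_right)
qed

lemma op_ext_antilinear_ext:
  "op_ext t (antilinear_ext \<sigma> X) p
     = (\<Sum>i\<in>Poly_Mapping.keys X. smult (cnj (Poly_Mapping.lookup X i)) (t (\<sigma> i) p))"
  by (simp add: antilinear_ext_def op_ext_sum)

lemma lin_op_op_ext: "(\<And>i. lin_op (t i)) \<Longrightarrow> lin_op (op_ext t X)"
  unfolding op_ext_def [abs_def] by (rule lin_op_lincomb)

lemma op_ext_commutator:
  assumes lin: "\<And>i. lin_op (t i)"
  shows "commutator (op_ext t X) (op_ext t Y) p - op_ext t (bilinear_ext br X Y) p
    = (\<Sum>(i, j)\<in>Poly_Mapping.keys X \<times> Poly_Mapping.keys Y.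
         smult (Poly_Mapping.lookup X i * Poly_Mapping.lookup Y j)
           (commutator (t i) (t j) p - op_ext t (br i j) p))"
proof -
  have smult: "t i (smult c q) = smult c (t i q)" for i c q
    using lin[of i] by (simp add: lin_op_iff)
  have XY: "op_ext t X (op_ext t Y p) = (\<Sum>i\<in>Poly_Mapping.keys X. \<Sum>j\<in>Poly_Mapping.keys Y.
      smult (Poly_Mapping.lookup X i * Poly_Mapping.lookup Y j) (t i (t j p)))" for X Y
    by (simp add: op_ext_def lin_op_sum[OF lin] smult smult_sum_right)
  have YX: "op_ext t Y (op_ext t X p) = (\<Sum>i\<in>Poly_Mapping.keys X. \<Sum>j\<in>Poly_Mapping.keys Y.
      smult (Poly_Mapping.lookup X i * Poly_Mapping.lookup Y j) (t j (t i p)))"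
    unfolding XY by (subst sum.swap) (simp add: mult.commute)
  have br: "op_ext t (bilinear_ext br X Y) p = (\<Sum>i\<in>Poly_Mapping.keys X. \<Sum>j\<in>Poly_Mapping.keys Y.
      smult (Poly_Mapping.lookup X i * Poly_Mapping.lookup Y j) (op_ext t (br i j) p))"
    by (simp add: bilinear_ext_def op_ext_sum op_ext_pscale)
  show ?thesis
    unfolding commutator_def XY[of X Y] YX br
    by (simp add: sum.cartesian_product [symmetric] sum_subtractf smult_diff_right)
qed

context graded_star_lie_algebra
begin

text \<open>
  This reduces the theorem to weights. The errors of projectivity for arbitrary elements are linear
  combinations of those for basis elements, so the latter suffice; and every word of degree 0 acts as a
  weighted shift of degree 0 with real weights, which is its own adjoint.
\<close>
lemma absolutely_symmetric_rep_shift_op: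
  fixes \<iota> :: "complex poly \<Rightarrow> 'h::chilbert_space"
  assumes unitary: "unitary_structure h ip" and completion: "is_completion ip \<iota>"
    and shift: "\<And>i. shift_op (t i) (dg i) (f i)"
    and adj: "\<And>i n. int n \<ge> dg i \<Longrightarrow>
        f i (real n) * wt ip (nat (int n - dg i)) = f (\<sigma> i) (real n - of_int (dg i)) * wt ip n"
    and comm: "\<And>i j. \<exists>g. shift_op (\<lambda>p. commutator (t i) (t j) p - op_ext t (br i j) p) (dg i + dg j) g \<and>
        g \<in> O(\<lambda>x. x powi (dg i + dg j - 1))"
  shows "absolutely_symmetric_rep (HS_ops \<iota>) ip (op_ext t)"
proof -
  have lin: "lin_op (t i)" for i
    using shift by (simp add: shift_op_def)
  have "(\<lambda>p. commutator (op_ext t X) (op_ext t Y) p - op_ext t (bracket X Y) p) \<in> HS_ops \<iota>" for X Y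
  proof (rule hs_summable_imp_HS_ops[OF unitary completion])
    let ?A = "\<lambda>(i, j) p. commutator (t i) (t j) p - op_ext t (br i j) p"
    let ?c = "\<lambda>(i, j). Poly_Mapping.lookup X i * Poly_Mapping.lookup Y j"
    have eq: "(\<lambda>p. commutator (op_ext t X) (op_ext t Y) p - op_ext t (bracket X Y) p)
        = (\<lambda>p. \<Sum>x\<in>Poly_Mapping.keys X \<times> Poly_Mapping.keys Y. smult (?c x) (?A x p))"
      unfolding bracket_def op_ext_commutator[OF lin] by (simp add: case_prod_beta)
    have A: "lin_op (?A x)" "hs_summable ip (?A x)" for x
      using comm[of "fst x" "snd x"] hs_summable_shift[OF unitary]
      by (auto simp: case_prod_beta shift_op_def)
    show "lin_op (\<lambda>p. commutator (op_ext t X) (op_ext t Y) p - op_ext t (bracket X Y) p)"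
      unfolding eq by (rule lin_op_lincomb) (rule A)
    show "hs_summable ip (\<lambda>p. commutator (op_ext t X) (op_ext t Y) p - op_ext t (bracket X Y) p)"
      unfolding eq by (rule hs_summable_lincomb[OF unitary]) (simp, rule A)
  qed
  then have rep: "projective_rep (HS_ops \<iota>) (op_ext t)"
    by (simp add: projective_rep_def lin_op_op_ext lin op_ext_add op_ext_pscale)
  have "is_adjoint ip (t i) (t (\<sigma> i))" for i
  proof (rule shift_op_adjoint[OF unitary shift _ adj])
    show "shift_op (t (\<sigma> i)) (- dg i) (f (\<sigma> i))"
      using shift[of "\<sigma> i"] by (simp add: dg_star)
  qed
  from is_adjoint_lincomb[OF unitary this]
  have "is_adjoint ip (op_ext t X) (op_ext t (star X))" for X
    unfolding star_def op_ext_antilinear_ext [abs_def] by (simp only: op_ext_def [abs_def])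
  then have sym: "symmetric_rep ip (op_ext t)"
    by (simp add: symmetric_rep_def)
  have word: "\<exists>g. shift_op (foldr (\<lambda>i A. op_ext t (basis i) \<circ> A) w id) (sum_list (map dg w)) g" for w
  proof (induction w)
    case Nil
    show ?case using shift_op_id by (auto simp: id_def)
  next
    case (Cons i w)
    then obtain g where g: "shift_op (foldr (\<lambda>i A. op_ext t (basis i) \<circ> A) w id) (sum_list (map dg w)) g"
      by blast
    have eq: "foldr (\<lambda>i A. op_ext t (basis i) \<circ> A) (i # w) id = t i \<circ> foldr (\<lambda>i A. op_ext t (basis i) \<circ> A) w id"
      by simp
    show ?case
      unfolding eq list.map sum_list.Cons by (rule exI) (rule shift_op_comp[OF shift g])
  qed
  have "is_adjoint ip (tensor_ext (op_ext t) a) (tensor_ext (op_ext t) a)"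
    if hom: "tensor_homogeneous 0 a" and real: "\<forall>w. Poly_Mapping.lookup a w \<in> \<real>" for a
  proof -
    define W where "W = (\<lambda>w. foldr (\<lambda>i A. op_ext t (basis i) \<circ> A) w id)"
    have "is_adjoint ip (W w) (W w)" if "w \<in> Poly_Mapping.keys a" for w
    proof -
      obtain g where "shift_op (W w) 0 g"
        using word[of w] hom \<open>w \<in> _\<close> by (auto simp: tensor_homogeneous_def W_def)
      then show ?thesis
        using shift_op_adjoint[OF unitary, of "W w" 0 g "W w" g] by simp
    qed
    then have "is_adjoint ip (\<lambda>p. \<Sum>w\<in>Poly_Mapping.keys a. smult (Poly_Mapping.lookup a w) (W w p))
        (\<lambda>p. \<Sum>w\<in>Poly_Mapping.keys a. smult (cnj (Poly_Mapping.lookup a w)) (W w p))"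
      by (rule is_adjoint_lincomb[OF unitary])
    moreover have "tensor_ext (op_ext t) a = (\<lambda>p. \<Sum>w\<in>Poly_Mapping.keys a. smult (Poly_Mapping.lookup a w) (W w p))"
      unfolding tensor_ext_def W_def by (rule ext) (rule op_ext_def)
    ultimately show ?thesis
      using real by (simp add: Reals_cnj_iff)
  qed
  with rep sym show ?thesis
    by (simp add: absolutely_symmetric_rep_def)
qed

end

section \<open>The two representations\<close>

lemma L_op_commutator:
  "\<exists>g. shift_op (\<lambda>p. commutator (L_op h j) (L_op h k) p - smult (of_int (j - k)) (L_op h (j + k) p)) (j + k) g \<and>
     g \<in> O(\<lambda>x. x powi (j + k - 1))"
  using shift_op_diff[OF shift_op_commutator[OF shift_op_L[of h j] shift_op_L[of h k]]
      shift_op_smult[OF shift_op_L[of h "j + k"], of "of_int (j - k)"]] lcoef_commutator[of h k j]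
  by auto

lemma L_op_J_op_commutator:
  "\<exists>g. shift_op (\<lambda>p. commutator (L_op h j) (J_op h k) p - smult (- of_int k) (J_op h (j + k) p)) (j + k) g \<and>
     g \<in> O(\<lambda>x. x powi (j + k - 1))"
  using shift_op_diff[OF shift_op_commutator[OF shift_op_L[of h j] shift_op_J[of h k]]
      shift_op_smult[OF shift_op_J[of h "j + k"], of "- of_int k"]] lcoef_jcoef_commutator[of h k j]
  by auto

lemma J_op_L_op_commutator:
  "\<exists>g. shift_op (\<lambda>p. commutator (J_op h k) (L_op h j) p - smult (of_int k) (J_op h (j + k) p)) (k + j) g \<and>
     g \<in> O(\<lambda>x. x powi (k + j - 1))"
proof -
  obtain g where g: "shift_op (\<lambda>p. commutator (L_op h j) (J_op h k) p - smult (- of_int k) (J_op h (j + k) p)) (j + k) g"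
    "g \<in> O(\<lambda>x. x powi (j + k - 1))"
    using L_op_J_op_commutator by blast
  have "(\<lambda>p. commutator (J_op h k) (L_op h j) p - smult (of_int k) (J_op h (j + k) p))
     = (\<lambda>p. smult (of_real (- 1)) (commutator (L_op h j) (J_op h k) p - smult (- of_int k) (J_op h (j + k) p)))"
    by (simp add: commutator_def fun_eq_iff)
  then show ?thesis
    using shift_op_smult[OF g(1), of "- 1"] g(2) by (auto simp: add.commute)
qed

lemma J_op_commutator:
  "\<exists>g. shift_op (commutator (J_op h j) (J_op h k)) (j + k) g \<and> g \<in> O(\<lambda>x. x powi (j + k - 1))"
  using shift_op_commutator[OF shift_op_J[of h j] shift_op_J[of h k]] jcoef_commutator[of h k j]
  by auto

fun wh_coef :: "real \<Rightarrow> wh_index \<Rightarrow> real \<Rightarrow> real" where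
  "wh_coef h (Witt k) = lcoef h k"
| "wh_coef h (Heis k) = jcoef h k"
| "wh_coef h Center = (\<lambda>x. 0)"

lemma shift_op_wh_ops: "shift_op (wh_ops h i) (wh_deg i) (wh_coef h i)"
  by (cases i) (simp_all add: shift_op_L shift_op_J shift_op_zero)

lemma wh_ops_commutator:
  "\<exists>g. shift_op (\<lambda>p. commutator (wh_ops h i) (wh_ops h j) p - op_ext (wh_ops h) (wh_br i j) p)
         (wh_deg i + wh_deg j) g \<and> g \<in> O(\<lambda>x. x powi (wh_deg i + wh_deg j - 1))"
proof (cases "i = Center \<or> j = Center")
  case True
  have "wh_ops h k 0 = 0" for k
    using shift_op_wh_ops[of h k] lin_op_zero by (simp add: shift_op_def)
  moreover have "wh_br i j = 0"
    using True by (cases i; cases j) auto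
  ultimately have "(\<lambda>p. commutator (wh_ops h i) (wh_ops h j) p - op_ext (wh_ops h) (wh_br i j) p) = (\<lambda>p. 0)"
    using True by (auto simp: commutator_def fun_eq_iff)
  then show ?thesis using shift_op_zero by (auto intro!: exI[of _ "\<lambda>_. 0"])
next
  case False
  then show ?thesis
    using L_op_commutator L_op_J_op_commutator J_op_L_op_commutator J_op_commutator
    by (cases i; cases j) auto
qed

theorem mainTheorem1:
  fixes h :: real
    and ip :: "complex poly \<Rightarrow> complex poly \<Rightarrow> complex"
    and \<iota> :: "complex poly \<Rightarrow> 'h::chilbert_space"
  assumes "unitary_structure h ip"
    and "is_completion ip \<iota>"
  shows "witt.absolutely_symmetric_rep (HS_ops \<iota>) ip (op_ext (L_op h)) \<and>
         witt_heis.absolutely_symmetric_rep (HS_ops \<iota>) ip (op_ext (wh_ops h))"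
proof
  show "witt.absolutely_symmetric_rep (HS_ops \<iota>) ip (op_ext (L_op h))"
  proof (rule witt.absolutely_symmetric_rep_shift_op[OF assms])
    show "shift_op (L_op h k) k (lcoef h k)" for k
      by (rule shift_op_L)
    show "lcoef h k (real n) * wt ip (nat (int n - k)) = lcoef h (- k) (real n - of_int k) * wt ip n"
      if "int n \<ge> k" for k n
      by (rule lcoef_wt[OF assms(1) that])
    show "\<exists>g. shift_op (\<lambda>p. commutator (L_op h j) (L_op h k) p - op_ext (L_op h) (witt_br j k) p) (j + k) g \<and>
       g \<in> O(\<lambda>x. x powi (j + k - 1))" for j k
      using L_op_commutator[of h j k] by (simp add: witt_br_def)
  qed
  show "witt_heis.absolutely_symmetric_rep (HS_ops \<iota>) ip (op_ext (wh_ops h))"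
  proof (rule witt_heis.absolutely_symmetric_rep_shift_op[OF assms shift_op_wh_ops _ wh_ops_commutator])
    show "wh_coef h i (real n) * wt ip (nat (int n - wh_deg i))
        = wh_coef h (wh_star i) (real n - of_int (wh_deg i)) * wt ip n"
      if "int n \<ge> wh_deg i" for i n
      using that by (cases i) (simp_all add: lcoef_wt[OF assms(1)] jcoef_wt[OF assms(1)])
  qed
qed

end
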